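(* Let $\mathsf X\subseteq\{\mathsf d,\mathsf t,\mathsf b,\mathsf 4,\mathsf 5\}$ be 45-closed and let $\Gamma$ be a nested sequent. Then: (i) if $\Gamma$ is $\mathsf X$-valid then $\mathsf K+\Diamond\mathsf X_{\mathsf c}\vdash\Gamma$; (ii) if the procedure $\mathit{prove}(\Gamma,\mathsf X)$ fails, then there is a finite $\mathsf X$-frame in which $\Gamma$ is not valid.
   Context: Formulas: $A::=p\mid\bar p\mid A\vee A\mid A\wedge A\mid\Diamond A\mid\Box A$, with $\bar A$ defined by De Morgan laws. A nested sequent is a finite multiset of formulas and boxed sequents $[\Delta]$; its corresponding formula of $A_1,\dots,A_m,[\Delta_1],\dots,[\Delta_n]$ is $A_1\vee\dots\vee A_m\vee\Box F_1\vee\dots\vee\Box F_n$ ($F_j$ corresponding formula of $\Delta_j$; $\bot=p\wedge\bar p$ if empty); validity of a sequent means validity of its corresponding formula. The corresponding tree of this sequent has root labelled $\{A_1,\dots,A_m\}$ and the trees of $\Delta_1,\dots,\Delta_n$ as children. Contexts $\Gamma\{\ \}$, filling $\Gamma\{\Delta\}$, binary contexts and depth of $\Gamma\{\ \}\{\emptyset\}$ (number of boxes around the first hole) as usual. Rules (premises / conclusion): axiom $\Gamma\{p,\bar p\}$; $\wedge$: $\Gamma\{A\},\Gamma\{B\}/\Gamma\{A\wedge B\}$; $\vee$: $\Gamma\{A,B\}/\Gamma\{A\vee B\}$; $\Box$: $\Gamma\{[A]\}/\Gamma\{\Box A\}$; $\Diamond\mathsf k_{\mathsf c}$: $\Gamma\{\Diamond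 A,[\Delta,A]\}/\Gamma\{\Diamond A,[\Delta]\}$; $\Diamond\mathsf d_{\mathsf c}$: $\Gamma\{\Diamond A,[A]\}/\Gamma\{\Diamond A\}$; $\Diamond\mathsf t_{\mathsf c}$: $\Gamma\{\Diamond A,A\}/\Gamma\{\Diamond A\}$; $\Diamond\mathsf b_{\mathsf c}$: $\Gamma\{[\Delta,\Diamond A],A\}/\Gamma\{[\Delta,\Diamond A]\}$; $\Diamond\mathsf 4_{\mathsf c}$: $\Gamma\{\Diamond A,[\Delta,\Diamond A]\}/\Gamma\{\Diamond A,[\Delta]\}$; $\Diamond\mathsf 5_{\mathsf c}$: $\Gamma\{\Diamond A\}\{\Diamond A\}/\Gamma\{\Diamond A\}\{\emptyset\}$ if depth of $\Gamma\{\ \}\{\emptyset\}>0$. $\mathsf K=\{\wedge,\vee,\Box,\Diamond\mathsf k_{\mathsf c}\}$ (with the axiom); $\mathsf K+\Diamond\mathsf X_{\mathsf c}$ adds $\Diamond\rho_{\mathsf c}$ for $\rho\in\mathsf X$. $\vdash$ is provability by finite proof trees with axiom leaves. Semantics: Kripke frames; frame conditions $\mathsf d$ serial, $\mathsf t$ reflexive, $\mathsf b$ symmetric, $\mathsf 4$ transitive, $\mathsf 5$ euclidean; $\mathsf X$-frame, $\mathsf X$-valid as usual. $\mathsf X$ is 45-closed if for each $\rho\in\{\mathsf 4,\mathsf 5\}$: if all $\mathsf X$-frames satisfy the condition of $\rho$ then $\rho\in\mathsf X$. The procedure: the set sequent of $A_1,\dots,A_m,[\Delta_1],\dots,[\Delta_n]$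 is the underlying set of $A_1,\dots,A_m,[\Lambda_1],\dots,[\Lambda_n]$ where $\Lambda_j$ is the set sequent of $\Delta_j$. For each rule $\rho$ define $\rho^\circ=\rho$ except: $\wedge^\circ$: $\Gamma\{A\wedge B,A\},\Gamma\{A\wedge B,B\}/\Gamma\{A\wedge B\}$; $\vee^\circ$: $\Gamma\{A\vee B,A,B\}/\Gamma\{A\vee B\}$; $\Box^\circ$: $\Gamma\{\Box A,[A]\}/\Gamma\{\Box A\}$ where in the conclusion the node of $\Box A$ has no child node containing $A$; $\Diamond\mathsf d_{\mathsf c}^\circ$: $\Gamma\{\Diamond A,[A]\}/\Gamma\{\Diamond A\}$ where in the conclusion the node of $\Diamond A$ has no child node. Moreover every $\rho^\circ$ may only be applied if each premise has a set sequent different from that of the conclusion. For a system $\mathcal S$, $\mathcal S^\circ=\{\rho^\circ:\rho\in\mathcal S\}$. A leaf of a sequent's tree is cyclic if some inner node carries the same set of formulas; a node is finished for $\mathcal S$ if no rule of $\mathcal S$ applies to a formula in it; a sequent is finished if all its nodes are finished or cyclic. $\mathit{prove}(\Gamma,\mathsf X)$ builds a derivation tree for $\Gamma$ bottom-up applying rules of $(\mathsf K+\Diamond\mathsf X_{\mathsf c})^\circ$ to non-axiomatic unfinished leaves as follows: repeat (step 1) apply the rules in $((\mathsf K+\Diamond\mathsf X_{\mathsf c})\setminus\{\Box,\Diamond\mathsf d_{\mathsf c}\})^\circ$ as long as possible; (step 2) wherever possible apply the rules in $(\{\Box\}\cup(\Diamond\mathsf X_{\mathsf c}\cap\{\Diamond\mathsf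 d_{\mathsf c}\}))^\circ$ once; until each non-axiomatic derivation leaf is finished. It fails if it terminates and some derivation leaf is non-axiomatic.
   Formalization: In (ii) the procedure is corrected, since as written it fails on some valid sequents: a cyclic leaf must still be finished for the step-1 rules, and premise and conclusion set sequents are compared at every node, not only at the root. Frames have natural-number worlds. *)

theory Defs
  imports "HOL-Library.Multiset" "HOL-Library.FSet"
begin

section \<open>Formulas and nested sequents\<close>

datatype fm = Pos nat | Neg nat | Or fm fm | And fm fm | Dia fm | Box fm

datatype seq = Seq (forms: "fm multiset") (children: "seq multiset")

instantiation seq :: comm_monoid_add
begin

definition zero_seq :: seq where
  "0 = Seq {#} {#}"

definition plus_seq :: "seq \<Rightarrow> seq \<Rightarrow> seq" where
  "\<Delta> + \<Lambda> = Seq (forms \<Delta> + forms \<Lambda>) (children \<Delta> + children \<Lambda>)"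

instance
  by standard (simp_all add: zero_seq_def plus_seq_def ac_simps)

end

text \<open>With \<open>+\<close> for the comma of sequents, the sequent \<open>A, [\<Delta>]\<close> is \<open>fs A + bx \<Delta>\<close>.\<close>

definition fs :: "fm \<Rightarrow> seq" where
  "fs A = Seq {#A#} {#}"

definition bx :: "seq \<Rightarrow> seq" where
  "bx \<Delta> = Seq {#} {#\<Delta>#}"

fun disj :: "fm list \<Rightarrow> fm" where
  "disj [] = And (Pos 0) (Neg 0)"
| "disj [A] = A"
| "disj (A # B # Cs) = Or A (disj (B # Cs))"

text \<open>A multiset does not order its elements, so the disjuncts are listed in an arbitrary order.\<close>

definition listing :: "'a multiset \<Rightarrow> 'a list" where
  "listing M = (SOME xs. mset xs = M)"

primrec formula_of :: "seq \<Rightarrow> fm" where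
  "formula_of (Seq As Ds) =
     disj (listing As @ map Box (listing (image_mset formula_of Ds)))"


section \<open>Kripke semantics\<close>

datatype axm = AxD | AxT | AxB | Ax4 | Ax5

primrec sat :: "('w \<times> 'w) set \<Rightarrow> (nat \<Rightarrow> 'w set) \<Rightarrow> 'w \<Rightarrow> fm \<Rightarrow> bool" where
  "sat R V w (Pos p) \<longleftrightarrow> w \<in> V p"
| "sat R V w (Neg p) \<longleftrightarrow> w \<notin> V p"
| "sat R V w (Or A B) \<longleftrightarrow> sat R V w A \<or> sat R V w B"
| "sat R V w (And A B) \<longleftrightarrow> sat R V w A \<and> sat R V w B"
| "sat R V w (Dia A) \<longleftrightarrow> (\<exists>v. (w, v) \<in> R \<and> sat R V v A)"
| "sat R V w (Box A) \<longleftrightarrow> (\<forall>v. (w, v) \<in> R \<longrightarrow> sat R V v A)"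

definition frame :: "'w set \<Rightarrow> ('w \<times> 'w) set \<Rightarrow> bool" where
  "frame W R \<longleftrightarrow> W \<noteq> {} \<and> R \<subseteq> W \<times> W"

primrec frame_cond :: "axm \<Rightarrow> 'w set \<Rightarrow> ('w \<times> 'w) set \<Rightarrow> bool" where
  "frame_cond AxD W R \<longleftrightarrow> (\<forall>x\<in>W. \<exists>y\<in>W. (x, y) \<in> R)"
| "frame_cond AxT W R \<longleftrightarrow> refl_on W R"
| "frame_cond AxB W R \<longleftrightarrow> sym R"
| "frame_cond Ax4 W R \<longleftrightarrow> trans R"
| "frame_cond Ax5 W R \<longleftrightarrow> (\<forall>x y z. (x, y) \<in> R \<longrightarrow> (x, z) \<in> R \<longrightarrow> (y, z) \<in> R)"

definition X_frame :: "axm set \<Rightarrow> 'w set \<Rightarrow> ('w \<times> 'w) set \<Rightarrow> bool" where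
  "X_frame X W R \<longleftrightarrow> frame W R \<and> (\<forall>\<rho>\<in>X. frame_cond \<rho> W R)"

definition valid_in :: "'w set \<Rightarrow> ('w \<times> 'w) set \<Rightarrow> seq \<Rightarrow> bool" where
  "valid_in W R \<Gamma> \<longleftrightarrow> (\<forall>V. \<forall>w\<in>W. sat R V w (formula_of \<Gamma>))"

text \<open>
  HOL cannot quantify over all types of worlds inside a formula. Frames whose worlds are natural
  numbers represent all countable frames. The frame conditions and the standard translation of a
  modal formula are first-order, so by the downward Loewenheim-Skolem theorem \<open>X_valid\<close> and
  \<open>closed45\<close> do not depend on this choice.
\<close>

definition X_valid :: "axm set \<Rightarrow> seq \<Rightarrow> bool" where
  "X_valid X \<Gamma> \<longleftrightarrow> (\<forall>(W::nat set) R. X_frame X W R \<longrightarrow> valid_in W R \<Gamma>)"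

definition closed45 :: "axm set \<Rightarrow> bool" where
  "closed45 X \<longleftrightarrow>
     (\<forall>\<rho>\<in>{Ax4, Ax5}. (\<forall>(W::nat set) R. X_frame X W R \<longrightarrow> frame_cond \<rho> W R) \<longrightarrow> \<rho> \<in> X)"


section \<open>Contexts\<close>

text \<open>\<open>Hole \<Lambda>\<close> is the context \<open>\<Lambda>, { }\<close> and \<open>Under \<Lambda> \<Gamma>\<close> is \<open>\<Lambda>, [\<Gamma>{ }]\<close>.\<close>

datatype ctx = Hole seq | Under seq ctx

primrec fill :: "ctx \<Rightarrow> seq \<Rightarrow> seq" where
  "fill (Hole \<Lambda>) \<Delta> = \<Lambda> + \<Delta>"
| "fill (Under \<Lambda> \<Gamma>) \<Delta> = \<Lambda> + bx (fill \<Gamma> \<Delta>)"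

primrec depth :: "ctx \<Rightarrow> nat" where
  "depth (Hole \<Lambda>) = 0"
| "depth (Under \<Lambda> \<Gamma>) = Suc (depth \<Gamma>)"

text \<open>\<open>at_hole \<Gamma>\<close> is what shares the node of the hole with the hole; \<open>outer \<Gamma>\<close> is the context
  left when this is removed too, so that \<open>fill \<Gamma> \<Delta> = fill (outer \<Gamma>) (at_hole \<Gamma> + \<Delta>)\<close>.\<close>

primrec at_hole :: "ctx \<Rightarrow> seq" where
  "at_hole (Hole \<Lambda>) = \<Lambda>"
| "at_hole (Under \<Lambda> \<Gamma>) = at_hole \<Gamma>"

primrec outer :: "ctx \<Rightarrow> ctx" where
  "outer (Hole \<Lambda>) = Hole 0"
| "outer (Under \<Lambda> \<Gamma>) = Under \<Lambda> (outer \<Gamma>)"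

text \<open>\<open>inbox \<Gamma> \<Delta>\<close> is the context \<open>\<Gamma>{[\<Delta>, { }]}\<close>.\<close>

primrec inbox :: "ctx \<Rightarrow> seq \<Rightarrow> ctx" where
  "inbox (Hole \<Lambda>) \<Delta> = Under \<Lambda> (Hole \<Delta>)"
| "inbox (Under \<Lambda> \<Gamma>) \<Delta> = Under \<Lambda> (inbox \<Gamma> \<Delta>)"

text \<open>\<open>plus_ctx \<Gamma> \<Delta>\<close> is the context \<open>\<Gamma>{{ }, \<Delta>}\<close>.\<close>

primrec plus_ctx :: "ctx \<Rightarrow> seq \<Rightarrow> ctx" where
  "plus_ctx (Hole \<Lambda>) \<Delta> = Hole (\<Lambda> + \<Delta>)"
| "plus_ctx (Under \<Lambda> \<Gamma>) \<Delta> = Under \<Lambda> (plus_ctx \<Gamma> \<Delta>)"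

text \<open>
  Binary contexts. The two holes are in the same node (\<open>Holes \<Lambda>\<close>), only the first or only the
  second is in the root node (\<open>First \<Lambda> \<Gamma>\<close>, \<open>Second \<Lambda> \<Gamma>\<close>), both are inside the same child of the
  root (\<open>Under2 \<Lambda> \<Gamma>\<close>) or they are inside two different children (\<open>Split \<Lambda> \<Gamma>1 \<Gamma>2\<close>).
\<close>

datatype ctx2 =
  Holes seq | First seq ctx | Second seq ctx | Under2 seq ctx2 | Split seq ctx ctx

text \<open>\<open>fill2nd \<Gamma> \<Delta>\<close> is the context \<open>\<Gamma>{ }{\<Delta>}\<close>.\<close>

primrec fill2nd :: "ctx2 \<Rightarrow> seq \<Rightarrow> ctx" where
  "fill2nd (Holes \<Lambda>) \<Delta> = Hole (\<Lambda> + \<Delta>)"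
| "fill2nd (First \<Lambda> \<Gamma>) \<Delta> = Hole (\<Lambda> + bx (fill \<Gamma> \<Delta>))"
| "fill2nd (Second \<Lambda> \<Gamma>) \<Delta> = Under (\<Lambda> + \<Delta>) \<Gamma>"
| "fill2nd (Under2 \<Lambda> \<Gamma>) \<Delta> = Under \<Lambda> (fill2nd \<Gamma> \<Delta>)"
| "fill2nd (Split \<Lambda> \<Gamma>1 \<Gamma>2) \<Delta> = Under (\<Lambda> + bx (fill \<Gamma>2 \<Delta>)) \<Gamma>1"

definition fill2 :: "ctx2 \<Rightarrow> seq \<Rightarrow> seq \<Rightarrow> seq" where
  "fill2 \<Gamma> \<Delta> \<Lambda> = fill (fill2nd \<Gamma> \<Lambda>) \<Delta>"


section \<open>The sequent systems\<close>

datatype rule = RAnd | ROr | RBox | RDiaK | RDia axm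

definition axiomatic :: "seq \<Rightarrow> bool" where
  "axiomatic \<Delta> \<longleftrightarrow> (\<exists>\<Gamma> p. \<Delta> = fill \<Gamma> (fs (Pos p) + fs (Neg p)))"

text \<open>\<open>inst \<rho> \<Gamma> ps c\<close>: premises \<open>ps\<close> and conclusion \<open>c\<close> form an instance of \<open>\<rho>\<close>, and the formula
  of \<open>c\<close> to which \<open>\<rho>\<close> is applied is in the hole of \<open>\<Gamma>\<close>.\<close>

inductive inst :: "rule \<Rightarrow> ctx \<Rightarrow> seq list \<Rightarrow> seq \<Rightarrow> bool" where
  "inst RAnd \<Gamma> [fill \<Gamma> (fs A), fill \<Gamma> (fs B)] (fill \<Gamma> (fs (And A B)))"
| "inst ROr \<Gamma> [fill \<Gamma> (fs A + fs B)] (fill \<Gamma> (fs (Or A B)))"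
| "inst RBox \<Gamma> [fill \<Gamma> (bx (fs A))] (fill \<Gamma> (fs (Box A)))"
| "inst RDiaK (plus_ctx \<Gamma> (bx \<Delta>))
     [fill \<Gamma> (fs (Dia A) + bx (\<Delta> + fs A))] (fill \<Gamma> (fs (Dia A) + bx \<Delta>))"
| "inst (RDia AxD) \<Gamma> [fill \<Gamma> (fs (Dia A) + bx (fs A))] (fill \<Gamma> (fs (Dia A)))"
| "inst (RDia AxT) \<Gamma> [fill \<Gamma> (fs (Dia A) + fs A)] (fill \<Gamma> (fs (Dia A)))"
| "inst (RDia AxB) (inbox \<Gamma> \<Delta>)
     [fill \<Gamma> (bx (\<Delta> + fs (Dia A)) + fs A)] (fill \<Gamma> (bx (\<Delta> + fs (Dia A))))"
| "inst (RDia Ax4) (plus_ctx \<Gamma> (bx \<Delta>))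
     [fill \<Gamma> (fs (Dia A) + bx (\<Delta> + fs (Dia A)))] (fill \<Gamma> (fs (Dia A) + bx \<Delta>))"
| "depth (fill2nd \<Gamma> 0) > 0 \<Longrightarrow>
   inst (RDia Ax5) (fill2nd \<Gamma> 0)
     [fill2 \<Gamma> (fs (Dia A)) (fs (Dia A))] (fill2 \<Gamma> (fs (Dia A)) 0)"

definition KX :: "axm set \<Rightarrow> rule set" where
  "KX X = {RAnd, ROr, RBox, RDiaK} \<union> RDia ` X"

inductive provable :: "rule set \<Rightarrow> seq \<Rightarrow> bool" for S where
  Ax: "axiomatic \<Gamma> \<Longrightarrow> provable S \<Gamma>"
| Rule: "\<rho> \<in> S \<Longrightarrow> inst \<rho> \<Gamma> ps c \<Longrightarrow> (\<And>p. p \<in> set ps \<Longrightarrow> provable S p) \<Longrightarrow> provable S c"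


section \<open>Set sequents and the rules of the procedure\<close>

datatype sseq = SSeq "fm fset" "sseq fset"

primrec set_seq :: "seq \<Rightarrow> sseq" where
  "set_seq (Seq As Ds) =
     SSeq (Abs_fset (set_mset As)) (Abs_fset (set_mset (image_mset set_seq Ds)))"

text \<open>
  A node of \<open>\<Delta>\<close> is given by its surrounding context, whose hole is alone in its node, and by the
  subsequent \<open>N\<close> of \<open>\<Delta>\<close> at this node. Occurrences of nodes with the same surrounding context
  are exchanged by an automorphism of \<open>\<Delta>\<close>, so they need not be distinguished.
\<close>

definition node :: "seq \<Rightarrow> ctx \<Rightarrow> seq \<Rightarrow> bool" where
  "node \<Delta> \<Gamma> N \<longleftrightarrow> at_hole \<Gamma> = 0 \<and> \<Delta> = fill \<Gamma> N"

text \<open>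
  The set sequents of \<open>\<Delta>\<close> and \<open>\<Lambda>\<close> are compared at every node and not only at the root (the case
  \<open>\<Gamma> = Hole 0\<close>). The two comparisons of a premise with its conclusion only disagree if some
  node has two children with the same set sequent: at the root, the effect of a rule applied in
  the first child of \<open>[A \<and> B], [A \<and> B], [A \<and> B, A]\<close> is invisible, as the changed child
  coincides with the third one and its old form survives as the second one. A procedure that only
  compares at the root takes nodes to be finished to which rules have not been applied, and it
  fails on the following sequent, which is valid in all symmetric frames, for \<open>X = {b}\<close> and
  \<open>C = \<Diamond>\<Diamond>r\<close>: the sequent \<open>[r*, [\<box>C]], [s, r, u, u, x, x, y, y, z, z, z', z', v]\<close> where
  \<open>r*\<close> is the negation of \<open>r\<close> and
  \<open>u = [\<box>C, [q]]\<close>, \<open>x = [\<box>C, [q], [C]]\<close>, \<open>y = [\<box>C, \<Diamond>r, [q], [C]]\<close>,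
  \<open>z = [\<box>C, \<Diamond>r, [q, r], [C]]\<close>, \<open>z' = [\<box>C, \<Diamond>r, [q], [C, r]]\<close>,
  \<open>v = [\<box>C, \<Diamond>r, [q, r], [C, r]]\<close>.
\<close>

definition set_different :: "seq \<Rightarrow> seq \<Rightarrow> bool" where
  "set_different \<Delta> \<Lambda> \<longleftrightarrow>
     (\<exists>\<Gamma> N M. node \<Delta> \<Gamma> N \<and> node \<Lambda> \<Gamma> M \<and> set_seq N \<noteq> set_seq M)"

inductive circ_inst :: "rule \<Rightarrow> ctx \<Rightarrow> seq list \<Rightarrow> seq \<Rightarrow> bool" where
  "circ_inst RAnd \<Gamma> [fill \<Gamma> (fs (And A B) + fs A), fill \<Gamma> (fs (And A B) + fs B)]
     (fill \<Gamma> (fs (And A B)))"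
| "circ_inst ROr \<Gamma> [fill \<Gamma> (fs (Or A B) + fs A + fs B)] (fill \<Gamma> (fs (Or A B)))"
| "(\<forall>\<Delta>\<in>#children (at_hole \<Gamma>). A \<notin># forms \<Delta>) \<Longrightarrow>
   circ_inst RBox \<Gamma> [fill \<Gamma> (fs (Box A) + bx (fs A))] (fill \<Gamma> (fs (Box A)))"
| "children (at_hole \<Gamma>) = {#} \<Longrightarrow>
   circ_inst (RDia AxD) \<Gamma> [fill \<Gamma> (fs (Dia A) + bx (fs A))] (fill \<Gamma> (fs (Dia A)))"
| "\<rho> \<in> {RDiaK, RDia AxT, RDia AxB, RDia Ax4, RDia Ax5} \<Longrightarrow> inst \<rho> \<Gamma> ps c \<Longrightarrow>
   circ_inst \<rho> \<Gamma> ps c"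

definition circ :: "rule \<Rightarrow> ctx \<Rightarrow> seq list \<Rightarrow> seq \<Rightarrow> bool" where
  "circ \<rho> \<Gamma> ps c \<longleftrightarrow> circ_inst \<rho> \<Gamma> ps c \<and> (\<forall>p\<in>set ps. set_different p c)"


section \<open>The procedure\<close>

definition cyclic :: "seq \<Rightarrow> seq \<Rightarrow> bool" where
  "cyclic \<Delta> N \<longleftrightarrow> children N = {#} \<and>
     (\<exists>\<Gamma> M. node \<Delta> \<Gamma> M \<and> children M \<noteq> {#} \<and> set_mset (forms M) = set_mset (forms N))"

text \<open>The node of \<open>\<Delta>\<close> with surrounding context \<open>\<Gamma>\<close> is finished for the circled rules of \<open>S\<close>.\<close>

definition node_finished :: "rule set \<Rightarrow> seq \<Rightarrow> ctx \<Rightarrow> bool" where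
  "node_finished S \<Delta> \<Gamma> \<longleftrightarrow> \<not> (\<exists>\<rho>\<in>S. \<exists>\<Gamma>' ps. outer \<Gamma>' = \<Gamma> \<and> circ \<rho> \<Gamma>' ps \<Delta>)"

definition step1_rules :: "axm set \<Rightarrow> rule set" where
  "step1_rules X = KX X - {RBox, RDia AxD}"

definition step2_rules :: "axm set \<Rightarrow> rule set" where
  "step2_rules X = {RBox} \<union> (RDia ` X \<inter> {RDia AxD})"

text \<open>
  A cyclic leaf is only exempt from the rules that create nodes, that is, it must be finished for
  the rules of step 1. If neither \<open>b\<close> nor \<open>5\<close> is in \<open>X\<close>, then this holds anyway when all
  other nodes are finished or cyclic, for the inner node with the same formulas is finished. The
  rules for \<open>b\<close> and \<open>5\<close> move formulas out of the leaf towards the root. If they could be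
  skipped, then a leaf that step 2 has just created could be cyclic and stop the procedure
  at once, and the procedure would fail on valid sequents: on \<open>p*, \<box>\<Diamond>p, [s, [\<Diamond>p, [q]]]\<close> for
  \<open>X = {b}\<close>, where the new leaf \<open>[\<Diamond>p]\<close> of the root is to add \<open>p\<close> to the root, and on
  \<open>\<Diamond>p, [\<box>\<Diamond>p, [p*]]\<close> for \<open>X = {5}\<close> (\<open>p*\<close> being the negation of \<open>p\<close>).
\<close>

definition finished :: "axm set \<Rightarrow> seq \<Rightarrow> bool" where
  "finished X \<Delta> \<longleftrightarrow> (\<forall>\<Gamma> N. node \<Delta> \<Gamma> N \<longrightarrow>
     node_finished (KX X) \<Delta> \<Gamma> \<or> cyclic \<Delta> N \<and> node_finished (step1_rules X) \<Delta> \<Gamma>)"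

definition unfinished :: "axm set \<Rightarrow> seq \<Rightarrow> bool" where
  "unfinished X \<Delta> \<longleftrightarrow> \<not> axiomatic \<Delta> \<and> \<not> finished X \<Delta>"

text \<open>The procedure only inspects the leaves of the derivation tree built so far, so its state is
  the multiset of these leaves.\<close>

inductive step1 :: "axm set \<Rightarrow> seq multiset \<Rightarrow> seq multiset \<Rightarrow> bool" for X where
  "unfinished X c \<Longrightarrow> \<rho> \<in> step1_rules X \<Longrightarrow> circ \<rho> \<Gamma> ps c \<Longrightarrow>
   step1 X (add_mset c M) (M + mset ps)"

definition phase1 :: "axm set \<Rightarrow> seq multiset \<Rightarrow> seq multiset \<Rightarrow> bool" where
  "phase1 X M M' \<longleftrightarrow> (step1 X)\<^sup>*\<^sup>* M M' \<and> \<not> (\<exists>M''. step1 X M' M'')"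

definition step2_at_root :: "axm set \<Rightarrow> seq \<Rightarrow> seq \<Rightarrow> bool" where
  "step2_at_root X c p \<longleftrightarrow> (\<exists>\<rho>\<in>step2_rules X. \<exists>\<Lambda>. circ \<rho> (Hole \<Lambda>) [p] c)"

text \<open>
  \<open>pass X \<Delta> \<Delta>'\<close>: one application, wherever possible, of the rules of step 2 to \<open>\<Delta>\<close> yields
  \<open>\<Delta>'\<close>. The rules are applied to the nodes of \<open>\<Delta>\<close> only, not to the nodes that are created on the
  way. The provisos of these rules only concern the node of the principal formula
  and its children, so the node can be treated without its context, and
  they exclude a second application to the same formula.
\<close>

inductive pass :: "axm set \<Rightarrow> seq \<Rightarrow> seq \<Rightarrow> bool" for X where
  "rel_mset (pass X) Ds Ds' \<Longrightarrow>
   (step2_at_root X)\<^sup>*\<^sup>* (Seq As Ds') \<Delta> \<Longrightarrow> \<not> (\<exists>\<Delta>'. step2_at_root X \<Delta> \<Delta>') \<Longrightarrow>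
   pass X (Seq As Ds) \<Delta>"
monos multiset.rel_mono

definition phase2 :: "axm set \<Rightarrow> seq multiset \<Rightarrow> seq multiset \<Rightarrow> bool" where
  "phase2 X = rel_mset (\<lambda>\<Delta> \<Delta>'. if unfinished X \<Delta> then pass X \<Delta> \<Delta>' else \<Delta>' = \<Delta>)"

text \<open>\<open>repeat_until X M M'\<close>: the loop, started on the leaves \<open>M\<close>, can terminate with the leaves \<open>M'\<close>.
  The order of rule applications is left open, so \<open>M'\<close> need not be unique.\<close>

inductive repeat_until :: "axm set \<Rightarrow> seq multiset \<Rightarrow> seq multiset \<Rightarrow> bool" for X where
  stop: "phase1 X M M1 \<Longrightarrow> phase2 X M1 M2 \<Longrightarrow> (\<forall>\<Delta>\<in>#M2. \<not> unfinished X \<Delta>) \<Longrightarrow>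
         repeat_until X M M2"
| loop: "phase1 X M M1 \<Longrightarrow> phase2 X M1 M2 \<Longrightarrow> (\<exists>\<Delta>\<in>#M2. unfinished X \<Delta>) \<Longrightarrow>
         repeat_until X M2 M3 \<Longrightarrow> repeat_until X M M3"

definition prove_fails :: "seq \<Rightarrow> axm set \<Rightarrow> bool" where
  "prove_fails \<Gamma> X \<longleftrightarrow> (\<exists>M. repeat_until X {#\<Gamma>#} M \<and> (\<exists>\<Delta>\<in>#M. \<not> axiomatic \<Delta>))"

end

theory Submission
  imports Defs "HOL-Library.Countable"
begin

text \<open>
  Both parts read off a countermodel from a family of labelled nodes that is closed under the rules
  (a Hintikka structure). The accessibility relation is not built as a closure of the edges: it is
  taken as large as the labels permit, which makes the frame conditions a matter of the labels;
  45-closedness enters in the case distinction for \<open>4\<close> and \<open>5\<close>.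

  For (ii) the nodes are those of a finished leaf of the derivation tree; it is entailed by the end
  sequent since the rules of the procedure only add to a sequent. For (i) the nodes are those of
  the limit of an infinite fair run of the rules of \<open>K + \<Diamond>X\<close> through unprovable sequents, each node
  being labelled with all formulas that it has had at some stage. This needs neither termination of
  the procedure nor admissibility of weakening and contraction.
\<close>

section \<open>Semantics of sequents\<close>

text \<open>For a closure of the edges, diamonds would have to be followed along all chains that the
  closure creates; for the maximal relation only single edges are checked. Its definition is
  symmetric under \<open>b\<close> and transitive under \<open>4\<close>, but with both
  \<open>b\<close> and \<open>4\<close> this form is lost: there \<open>5\<close> has to be a rule
  of the system. Under \<open>5\<close> the diamonds of all nodes below the root reach every node,
  and only the root needs care: its diamonds are passed on as diamonds only under \<open>4\<close>,
  and the body of a diamond is forced into its label only under \<open>t\<close> or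
  \<open>b\<close>. The obstacle in (i) is that the rules consume conjunctions, disjunctions and
  boxes, so only literals and diamonds persist. This is enough: a consumed formula leaves its
  components behind in the same step, at its node or at a child, whereas what moves between existing
  nodes is caused by a diamond, which is still there when the move is scheduled.\<close>

abbreviation holds :: "('w \<times> 'w) set \<Rightarrow> (nat \<Rightarrow> 'w set) \<Rightarrow> 'w \<Rightarrow> seq \<Rightarrow> bool" where
  "holds R V w \<Delta> \<equiv> sat R V w (formula_of \<Delta>)"

lemma sat_disj: "sat R V w (disj As) \<longleftrightarrow> (\<exists>A\<in>set As. sat R V w A)"
  by (induction As rule: disj.induct) auto

lemma set_listing [simp]: "set (listing M) = set_mset M"
proof -
  have "mset (listing M) = M"
    unfolding listing_def by (rule someI_ex) (rule ex_mset)
  then show ?thesis by (metis set_mset_mset)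
qed

lemma holds_Seq:
  "holds R V w (Seq As Ds) \<longleftrightarrow>
     (\<exists>A\<in>#As. sat R V w A) \<or> (\<exists>D\<in>#Ds. \<forall>v. (w, v) \<in> R \<longrightarrow> holds R V v D)"
  by (simp add: sat_disj bex_Un)

declare formula_of.simps [simp del]

lemma holds_plus [simp]: "holds R V w (\<Delta> + \<Lambda>) \<longleftrightarrow> holds R V w \<Delta> \<or> holds R V w \<Lambda>"
  by (cases \<Delta>; cases \<Lambda>) (auto simp: plus_seq_def holds_Seq)

lemma holds_bx [simp]: "holds R V w (bx \<Delta>) \<longleftrightarrow> (\<forall>v. (w, v) \<in> R \<longrightarrow> holds R V v \<Delta>)"
  by (simp add: bx_def holds_Seq)

lemma holds_fill_mono:
  assumes "\<And>v. holds R V v \<Delta> \<Longrightarrow> holds R V v \<Lambda>" and "holds R V w (fill \<Gamma> \<Delta>)"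
  shows "holds R V w (fill \<Gamma> \<Lambda>)"
  using assms(2) by (induction \<Gamma> arbitrary: w) (auto intro: assms(1))


section \<open>Models from Hintikka structures\<close>

text \<open>Labels collect the formulas to be refuted. \<open>N\<close> stands for the worlds of the
  nodes below the root, where rule \<open>5\<close> may start. It is a parameter of its own, since a
  world may stand for several nodes and \<open>r\<close> may then belong to \<open>N\<close>. With
  \<open>root\<close>, a diamond of the root can enter \<open>N\<close> by \<open>4\<close>.\<close>

locale hintikka =
  fixes X :: "axm set" and L :: "'w \<Rightarrow> fm set" and W :: "'w set" and r :: 'w and N :: "'w set"
    and E :: "('w \<times> 'w) set"
  assumes W: "W = insert r N" and E_sub: "E \<subseteq> W \<times> N" and N_sub: "N \<subseteq> Range E"
    and root: "N \<noteq> {} \<Longrightarrow> r \<in> Domain E"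
    and clash: "w \<in> W \<Longrightarrow> Pos p \<in> L w \<Longrightarrow> Neg p \<notin> L w"
    and And: "w \<in> W \<Longrightarrow> And A B \<in> L w \<Longrightarrow> A \<in> L w \<or> B \<in> L w"
    and Or: "w \<in> W \<Longrightarrow> Or A B \<in> L w \<Longrightarrow> A \<in> L w \<and> B \<in> L w"
    and Box: "w \<in> W \<Longrightarrow> Box A \<in> L w \<Longrightarrow> \<exists>v. (w, v) \<in> E \<and> A \<in> L v"
    and K: "(w, v) \<in> E \<Longrightarrow> Dia A \<in> L w \<Longrightarrow> A \<in> L v"
    and D: "AxD \<in> X \<Longrightarrow> w \<in> W \<Longrightarrow> Dia A \<in> L w \<Longrightarrow> w \<in> Domain E"
    and T: "AxT \<in> X \<Longrightarrow> w \<in> W \<Longrightarrow> Dia A \<in> L w \<Longrightarrow> A \<in> L w"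
    and B: "AxB \<in> X \<Longrightarrow> (w, v) \<in> E \<Longrightarrow> Dia A \<in> L v \<Longrightarrow> A \<in> L w"
    and Four: "Ax4 \<in> X \<Longrightarrow> (w, v) \<in> E \<Longrightarrow> Dia A \<in> L w \<Longrightarrow> Dia A \<in> L v"
    and Five: "Ax5 \<in> X \<Longrightarrow> v \<in> N \<Longrightarrow> w \<in> W \<Longrightarrow> Dia A \<in> L v \<Longrightarrow> Dia A \<in> L w"

text \<open>Symmetric transitive frames are euclidean, and euclidean frames that are symmetric or
  reflexive are transitive. Closedness enters only through these three instances.\<close>

lemma closed45_cases:
  assumes "closed45 X"
  shows "AxB \<in> X \<Longrightarrow> Ax4 \<in> X \<Longrightarrow> Ax5 \<in> X" and "AxB \<in> X \<Longrightarrow> Ax5 \<in> X \<Longrightarrow> Ax4 \<in> X"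
    and "AxT \<in> X \<Longrightarrow> Ax5 \<in> X \<Longrightarrow> Ax4 \<in> X"
proof -
  have c: "\<rho> \<in> X" if "\<rho> \<in> {Ax4, Ax5}" "\<And>(W::nat set) R. X_frame X W R \<Longrightarrow> frame_cond \<rho> W R" for \<rho>
    by (rule assms[unfolded closed45_def, rule_format]) (use that in auto)
  show "AxB \<in> X \<Longrightarrow> Ax4 \<in> X \<Longrightarrow> Ax5 \<in> X"
  proof (rule c)
    fix W :: "nat set" and R
    assume "AxB \<in> X" "Ax4 \<in> X" "X_frame X W R"
    then have "frame_cond AxB W R" "frame_cond Ax4 W R" unfolding X_frame_def by blast+
    then have "sym R" "trans R" by simp_all
    then have "(y, z) \<in> R" if "(x, y) \<in> R" "(x, z) \<in> R" for x y z
      using that by (meson symD transD)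
    then show "frame_cond Ax5 W R" unfolding frame_cond.simps by blast
  qed simp
  show "AxB \<in> X \<Longrightarrow> Ax5 \<in> X \<Longrightarrow> Ax4 \<in> X"
  proof (rule c)
    fix W :: "nat set" and R
    assume "AxB \<in> X" "Ax5 \<in> X" "X_frame X W R"
    then have "frame_cond AxB W R" "frame_cond Ax5 W R" unfolding X_frame_def by blast+
    then have "sym R" and eu: "\<forall>x y z. (x, y) \<in> R \<longrightarrow> (x, z) \<in> R \<longrightarrow> (y, z) \<in> R"
      unfolding frame_cond.simps by blast+
    have "(x, z) \<in> R" if "(x, y) \<in> R" "(y, z) \<in> R" for x y z
      using eu[rule_format, OF symD[OF \<open>sym R\<close> that(1)] that(2)] .
    then show "frame_cond Ax4 W R" unfolding frame_cond.simps by (rule transI)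
  qed simp
  show "AxT \<in> X \<Longrightarrow> Ax5 \<in> X \<Longrightarrow> Ax4 \<in> X"
  proof (rule c)
    fix W :: "nat set" and R
    assume "AxT \<in> X" "Ax5 \<in> X" "X_frame X W R"
    then have "frame_cond AxT W R" "frame_cond Ax5 W R" "R \<subseteq> W \<times> W"
      unfolding X_frame_def frame_def by blast+
    then have "refl_on W R" "R \<subseteq> W \<times> W" and eu: "\<forall>x y z. (x, y) \<in> R \<longrightarrow> (x, z) \<in> R \<longrightarrow> (y, z) \<in> R"
      unfolding frame_cond.simps by blast+
    then have re: "(x, x) \<in> R" if "(x, y) \<in> R" for x y
      using that unfolding refl_on_def by blast
    have "(x, z) \<in> R" if "(x, y) \<in> R" "(y, z) \<in> R" for x y z
      using eu[rule_format, OF eu[rule_format, OF that(1) re[OF that(1)]] that(2)] .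
    then show "frame_cond Ax4 W R" unfolding frame_cond.simps by (rule transI)
  qed simp
qed

text \<open>Two demands pull in opposite directions: \<open>E \<subseteq> R\<close> gives boxes
  their witnesses, and the last conjunct keeps diamonds refuted. The cases are those in which a
  large relation between these bounds has a different shape.\<close>

lemma (in hintikka) relation:
  assumes c: "closed45 X"
  shows "\<exists>R. X_frame X W R \<and> E \<subseteq> R \<and> (\<forall>w v A. (w, v) \<in> R \<longrightarrow> Dia A \<in> L w \<longrightarrow> A \<in> L v)"
proof -
  note E = E_sub N_sub
  have c45: "AxB \<in> X \<Longrightarrow> Ax4 \<in> X \<Longrightarrow> Ax5 \<in> X" "AxB \<in> X \<Longrightarrow> Ax5 \<in> X \<Longrightarrow> Ax4 \<in> X"
    "AxT \<in> X \<Longrightarrow> Ax5 \<in> X \<Longrightarrow> Ax4 \<in> X"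
    using closed45_cases[OF c] by blast+
  have frameI: "X_frame X W R" if "R \<subseteq> W \<times> W" "\<And>\<rho>. \<rho> \<in> X \<Longrightarrow> frame_cond \<rho> W R" for R
    using that W unfolding X_frame_def frame_def by blast
  \<comment> \<open>\<open>Five\<close> takes the diamond to a predecessor of \<open>v\<close>, and
    \<open>K\<close> takes its body from there to \<open>v\<close>.\<close>
  have NA: "A \<in> L v" if "Ax5 \<in> X" "w \<in> N" "v \<in> N" "Dia A \<in> L w" for w v A
    using E K Five[OF that(1,2)] that(3,4) by blast
  have full: "X_frame X W (W \<times> W)"
  proof (rule frameI)
    fix \<rho>
    show "frame_cond \<rho> W (W \<times> W)"
      by (cases \<rho>) (auto simp: refl_on_def intro: symI transI)
  qed simp
  consider "Ax5 \<notin> X" | "Ax5 \<in> X" "N = {}" "AxT \<in> X \<or> AxD \<in> X" | "Ax5 \<in> X" "N = {}" "AxT \<notin> X" "AxD \<notin> X"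
    | "Ax5 \<in> X" "N \<noteq> {}" "AxT \<in> X \<or> AxB \<in> X" | "Ax5 \<in> X" "N \<noteq> {}" "AxT \<notin> X" "AxB \<notin> X"
    by blast
  then show ?thesis
  proof cases
    case 1
    \<comment> \<open>The clauses for \<open>4\<close> and \<open>b\<close> are never both active
      here, as together they would give \<open>5\<close>. The \<open>b\<close> clause is the mirror
      image of the first one, so \<open>R\<close> is symmetric under \<open>b\<close>; the
      \<open>4\<close> clause makes \<open>R\<close> transitive.\<close>
    define R where "R = {(w, v). w \<in> W \<and> v \<in> W \<and> (\<forall>A. Dia A \<in> L w \<longrightarrow> A \<in> L v) \<and>
      (Ax4 \<in> X \<longrightarrow> (\<forall>A. Dia A \<in> L w \<longrightarrow> Dia A \<in> L v)) \<and>
      (AxB \<in> X \<longrightarrow> (\<forall>A. Dia A \<in> L v \<longrightarrow> A \<in> L w))}"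
    have ER: "E \<subseteq> R"
      using E(1) W by (auto simp: R_def dest: K Four B)
    moreover have "X_frame X W R"
    proof (rule frameI)
      fix \<rho> assume "\<rho> \<in> X"
      then show "frame_cond \<rho> W R"
      proof (cases \<rho>)
        case AxD
        have "\<exists>y\<in>W. (x, y) \<in> R" if "x \<in> W" for x
        proof (cases "\<exists>A. Dia A \<in> L x")
          case True
          then obtain y where "(x, y) \<in> E" using D \<open>x \<in> W\<close> AxD \<open>\<rho> \<in> X\<close> by blast
          then show ?thesis using ER E(1) W by blast
        next
          \<comment> \<open>A world without diamonds satisfies all clauses vacuously towards
            itself.\<close>
          case False
          then show ?thesis using that by (auto simp: R_def)
        qed
        then show ?thesis using AxD by simp
      next
        case AxT
        then show ?thesis using T \<open>\<rho> \<in> X\<close> by (auto simp: R_def refl_on_def)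
      next
        case AxB
        then show ?thesis using c45(1) 1 \<open>\<rho> \<in> X\<close> by (auto simp: R_def intro!: symI)
      next
        case Ax4
        then have "AxB \<notin> X" using c45(1) 1 \<open>\<rho> \<in> X\<close> by blast
        then show ?thesis using Ax4 \<open>\<rho> \<in> X\<close> by (auto simp: R_def intro!: transI)
      next
        case Ax5
        then show ?thesis using 1 \<open>\<rho> \<in> X\<close> by simp
      qed
    qed (auto simp: R_def)
    moreover have "\<forall>w v A. (w, v) \<in> R \<longrightarrow> Dia A \<in> L w \<longrightarrow> A \<in> L v"
      by (auto simp: R_def)
    ultimately show ?thesis by blast
  next
    \<comment> \<open>The only world is \<open>r\<close>, without edges. Under \<open>d\<close> it
      has no diamonds at all, under \<open>t\<close> their bodies are in its own label.\<close>
    case 2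
    have "E = {}" using E(1) 2(2) by blast
    then have "\<forall>w v A. (w, v) \<in> W \<times> W \<longrightarrow> Dia A \<in> L w \<longrightarrow> A \<in> L v"
      using 2(2,3) W T D by auto
    then show ?thesis using full E W by blast
  next
    case 3
    have "X_frame X W {}"
    proof (rule frameI)
      fix \<rho> assume "\<rho> \<in> X"
      with 3 show "frame_cond \<rho> W {}"
        by (cases \<rho>) (auto intro: symI transI)
    qed simp
    then show ?thesis using 3 E W by blast
  next
    case 4
    \<comment> \<open>Closedness supplies \<open>4\<close>, so a diamond of the root descends to a
      child as well, and \<open>5\<close> then copies every diamond to all worlds. As a target, the
      root is served by \<open>t\<close> or \<open>b\<close>.\<close>
    have "A \<in> L v" if "w \<in> W" "v \<in> W" and A: "Dia A \<in> L w" for w v A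
    proof -
      have X4: "Ax4 \<in> X" using 4 c45 by blast
      obtain u where u: "(r, u) \<in> E" "u \<in> N" using root[OF 4(2)] E(1) by blast
      have "\<exists>n\<in>N. Dia A \<in> L n"
      proof (cases "w \<in> N")
        case False
        then have "w = r" using that W by blast
        then show ?thesis using u Four X4 A by blast
      qed (use A in blast)
      then have all: "Dia A \<in> L x" if "x \<in> W" for x using Five 4 that by blast
      show ?thesis
      proof (cases "v \<in> N")
        case True
        then show ?thesis using NA 4 all W by blast
      next
        case False
        then have "v = r" using that W by blast
        then show ?thesis using T B 4 u all W by blast
      qed
    qed
    then show ?thesis using full E W by blast
  next
    case 5
    \<comment> \<open>No rule forces the body of a diamond into the label of the root now, so
      targets are confined to \<open>N\<close>. Two successors of a world then lie in
      \<open>N\<close>, where \<open>NA\<close> and \<open>Five\<close> make \<open>R\<close>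
      euclidean.\<close>
    define R where "R = {(w, v). w \<in> W \<and> v \<in> N \<and> (\<forall>A. Dia A \<in> L w \<longrightarrow> A \<in> L v) \<and>
      (Ax4 \<in> X \<longrightarrow> (\<forall>A. Dia A \<in> L w \<longrightarrow> Dia A \<in> L v))}"
    have ER: "E \<subseteq> R"
      using E(1) W by (auto simp: R_def dest: K Four)
    moreover have "X_frame X W R"
    proof (rule frameI)
      fix \<rho> assume "\<rho> \<in> X"
      then show "frame_cond \<rho> W R"
      proof (cases \<rho>)
        case AxD
        have "\<exists>y\<in>W. (x, y) \<in> R" if "x \<in> W" for x
        proof (cases "\<exists>A. Dia A \<in> L x")
          case True
          then obtain y where "(x, y) \<in> E" using D \<open>x \<in> W\<close> AxD \<open>\<rho> \<in> X\<close> by blast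
          then show ?thesis using ER E(1) W by blast
        next
          case False
          then show ?thesis using that 5(2) W by (auto simp: R_def)
        qed
        then show ?thesis using AxD by simp
      next
        case Ax4
        then show ?thesis using \<open>\<rho> \<in> X\<close> W by (auto simp: R_def intro!: transI)
      next
        case Ax5
        have "(y, z) \<in> R" if "(x, y) \<in> R" "(x, z) \<in> R" for x y z
          using that W NA[OF 5(1)] Five[OF 5(1)] unfolding R_def by blast
        then show ?thesis unfolding Ax5 frame_cond.simps by blast
      qed (use 5 \<open>\<rho> \<in> X\<close> in simp_all)
    qed (use W in \<open>auto simp: R_def\<close>)
    moreover have "\<forall>w v A. (w, v) \<in> R \<longrightarrow> Dia A \<in> L w \<longrightarrow> A \<in> L v"
      by (auto simp: R_def)
    ultimately show ?thesis by blast
  qed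
qed

section \<open>Transport of models to worlds that are natural numbers\<close>

lemma X_frame_inj:
  assumes fr: "X_frame X W R" and inj: "inj_on f W"
  shows "X_frame X (f ` W) (map_prod f f ` R)"
proof -
  have W: "W \<noteq> {}" and R: "R \<subseteq> W \<times> W" and c: "\<And>\<rho>. \<rho> \<in> X \<Longrightarrow> frame_cond \<rho> W R"
    using fr unfolding X_frame_def frame_def by blast+
  have inv: "\<exists>x y. a = f x \<and> b = f y \<and> (x, y) \<in> R" if "(a, b) \<in> map_prod f f ` R" for a b
    using that by auto
  \<comment> \<open>For \<open>4\<close> and \<open>5\<close> two edges share an image under
    \<open>f\<close>; injectivity makes them share a world.\<close>
  have eq: "x = y" if "f x = f y" "x \<in> W" "y \<in> W" for x y
    using inj that by (meson inj_onD)
  have "frame_cond \<rho> (f ` W) (map_prod f f ` R)" if "\<rho> \<in> X" for \<rho>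
  proof (cases \<rho>)
    case AxD
    then show ?thesis using c[OF that] by fastforce
  next
    case AxT
    then show ?thesis using c[OF that] by (force simp: refl_on_def)
  next
    case AxB
    then show ?thesis using c[OF that] by (auto intro!: symI dest: symD)
  next
    case Ax4
    have "(a, d) \<in> map_prod f f ` R" if ab: "(a, b) \<in> map_prod f f ` R" "(b, d) \<in> map_prod f f ` R" for a b d
    proof -
      obtain x y y' z where "a = f x" "b = f y" "(x, y) \<in> R" "b = f y'" "d = f z" "(y', z) \<in> R"
        using inv[OF ab(1)] inv[OF ab(2)] by blast
      moreover from this have "y = y'" using R eq by blast
      moreover have "trans R" using c[OF \<open>\<rho> \<in> X\<close>] Ax4 by simp
      ultimately have "(x, z) \<in> R" by (blast dest: transD)
      then show ?thesis using \<open>a = f x\<close> \<open>d = f z\<close> by auto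
    qed
    then show ?thesis using Ax4 by (simp add: trans_def)
  next
    case Ax5
    have "(b, d) \<in> map_prod f f ` R" if ab: "(a, b) \<in> map_prod f f ` R" "(a, d) \<in> map_prod f f ` R" for a b d
    proof -
      obtain x x' y z where "a = f x" "b = f y" "(x, y) \<in> R" "a = f x'" "d = f z" "(x', z) \<in> R"
        using inv[OF ab(1)] inv[OF ab(2)] by blast
      moreover from this have "x = x'" using R eq by blast
      moreover have "\<forall>x y z. (x, y) \<in> R \<longrightarrow> (x, z) \<in> R \<longrightarrow> (y, z) \<in> R" using c[OF \<open>\<rho> \<in> X\<close>] unfolding Ax5 frame_cond.simps .
      ultimately have "(y, z) \<in> R" by blast
      then show ?thesis using \<open>b = f y\<close> \<open>d = f z\<close> by auto
    qed
    then show ?thesis unfolding Ax5 frame_cond.simps by blast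
  qed
  then show ?thesis
    using W R unfolding X_frame_def frame_def by auto
qed

text \<open>\<open>V p\<close> is cut down to \<open>W\<close> because \<open>f\<close> is injective
  on \<open>W\<close> only: a world outside could have the same image as one inside.\<close>

lemma sat_inj:
  assumes R: "R \<subseteq> W \<times> W" and inj: "inj_on f W" and w: "w \<in> W"
  shows "sat (map_prod f f ` R) (\<lambda>p. f ` (V p \<inter> W)) (f w) A \<longleftrightarrow> sat R V w A"
  using w
proof (induction A arbitrary: w)
  case (Pos p)
  then show ?case using inj by (auto dest: inj_onD)
next
  case (Neg p)
  then show ?case using inj by (auto dest: inj_onD)
next
  case (Dia A)
  have "(f w, x) \<in> map_prod f f ` R \<longleftrightarrow> (\<exists>v. x = f v \<and> (w, v) \<in> R)" for x
    using R inj Dia.prems by (auto dest: inj_onD)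
  then show ?case using Dia R by auto
next
  case (Box A)
  have "(f w, x) \<in> map_prod f f ` R \<longleftrightarrow> (\<exists>v. x = f v \<and> (w, v) \<in> R)" for x
    using R inj Box.prems by (auto dest: inj_onD)
  moreover have "sat (map_prod f f ` R) (\<lambda>p. f ` (V p \<inter> W)) (f v) A \<longleftrightarrow> sat R V v A" if "(w, v) \<in> R" for v
    using R that by (intro Box.IH) blast
  ultimately show ?case by auto
qed auto

lemma (in hintikka) countermodel:
  fixes f :: "'w \<Rightarrow> nat"
  assumes c: "closed45 X" and inj: "inj_on f W"
  shows "\<exists>R V. X_frame X (f ` W) R \<and> (\<forall>w v. (w, v) \<in> E \<longrightarrow> (f w, f v) \<in> R) \<and>
    (\<forall>w\<in>W. \<forall>A\<in>L w. \<not> sat R V (f w) A)"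
proof -
  obtain R where R: "X_frame X W R" "E \<subseteq> R" "\<And>w v A. (w, v) \<in> R \<Longrightarrow> Dia A \<in> L w \<Longrightarrow> A \<in> L v"
    using relation[OF c] by blast
  \<comment> \<open>Atoms are true exactly where their negation has to be refuted;
    \<open>clash\<close> then makes the positive literals of a label false.\<close>
  define V where "V p = {w. Neg p \<in> L w}" for p
  have RW: "R \<subseteq> W \<times> W" using R(1) unfolding X_frame_def frame_def by blast
  have sat: "\<not> sat R V w A" if "w \<in> W" "A \<in> L w" for w A
    using that
  proof (induction A arbitrary: w)
    case (Pos p)
    then show ?case using clash by (auto simp: V_def)
  next
    case (Neg p)
    then show ?case by (simp add: V_def)
  next
    case (Or A B)
    then have "A \<in> L w \<and> B \<in> L w" using hintikka.Or[OF hintikka_axioms] by blast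
    with Or show ?case by simp
  next
    case (And A B)
    then have "A \<in> L w \<or> B \<in> L w" using hintikka.And[OF hintikka_axioms] by blast
    with And show ?case by auto
  next
    case (Dia A)
    then show ?case using R(3) RW by fastforce
  next
    case (Box A)
    then obtain v where "(w, v) \<in> E" "A \<in> L v" using hintikka.Box[OF hintikka_axioms] by blast
    with Box.IH[of v] show ?case using RW R(2) by auto
  qed
  show ?thesis
  proof (intro exI conjI allI impI ballI)
    show "X_frame X (f ` W) (map_prod f f ` R)" by (rule X_frame_inj[OF R(1) inj])
    show "(f w, f v) \<in> map_prod f f ` R" if "(w, v) \<in> E" for w v using R(2) that by auto
    show "\<not> sat (map_prod f f ` R) (\<lambda>p. f ` (V p \<inter> W)) (f w) A" if "w \<in> W" "A \<in> L w" for w A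
      using sat[OF that] sat_inj[OF RW inj that(1)] by simp
  qed
qed


section \<open>Contexts\<close>

lemma forms_children_simps [simp]:
  "forms (\<Delta> + \<Lambda>) = forms \<Delta> + forms \<Lambda>" "children (\<Delta> + \<Lambda>) = children \<Delta> + children \<Lambda>"
  "forms 0 = {#}" "children 0 = {#}"
  "forms (fs A) = {#A#}" "children (fs A) = {#}" "forms (bx \<Delta>) = {#}" "children (bx \<Delta>) = {#\<Delta>#}"
  by (simp_all add: plus_seq_def zero_seq_def fs_def bx_def)

lemma seq_eq_iff: "\<Delta> = \<Lambda> \<longleftrightarrow> forms \<Delta> = forms \<Lambda> \<and> children \<Delta> = children \<Lambda>"
  by (cases \<Delta>; cases \<Lambda>) simp

lemma fill_plus_ctx [simp]: "fill (plus_ctx \<Gamma> \<Delta>) \<Lambda> = fill \<Gamma> (\<Delta> + \<Lambda>)"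
  by (induction \<Gamma>) (simp_all add: ac_simps)

lemma fill_inbox [simp]: "fill (inbox \<Gamma> \<Delta>) \<Lambda> = fill \<Gamma> (bx (\<Delta> + \<Lambda>))"
  by (induction \<Gamma>) simp_all

lemma at_hole_simps [simp]:
  "at_hole (plus_ctx \<Gamma> \<Delta>) = at_hole \<Gamma> + \<Delta>" "at_hole (inbox \<Gamma> \<Delta>) = \<Delta>" "at_hole (outer \<Gamma>) = 0"
  by (induction \<Gamma>) simp_all

lemma outer_simps [simp]:
  "outer (plus_ctx \<Gamma> \<Delta>) = outer \<Gamma>" "outer (inbox \<Gamma> \<Delta>) = inbox \<Gamma> 0"
  by (induction \<Gamma>) simp_all

lemma outer_ident: "at_hole \<Gamma> = 0 \<Longrightarrow> outer \<Gamma> = \<Gamma>"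
  by (induction \<Gamma>) simp_all

lemma depth_simps [simp]:
  "depth (plus_ctx \<Gamma> \<Delta>) = depth \<Gamma>" "depth (inbox \<Gamma> \<Delta>) = Suc (depth \<Gamma>)" "depth (outer \<Gamma>) = depth \<Gamma>"
  by (induction \<Gamma>) simp_all

lemma split_form: "A \<in># forms N \<Longrightarrow> \<exists>\<Lambda>. N = \<Lambda> + fs A"
  by (rule exI[of _ "Seq (forms N - {#A#}) (children N)"]) (simp add: seq_eq_iff)

lemma split_child: "M \<in># children N \<Longrightarrow> \<exists>\<Lambda>. N = \<Lambda> + bx M"
  by (rule exI[of _ "Seq (forms N) (children N - {#M#})"]) (simp add: seq_eq_iff)

text \<open>\<open>\<Lambda>\<close> is the parent without the child that is entered. The final
  \<open>0\<close> leaves the hole alone in the child, as \<open>node\<close> demands.\<close>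

abbreviation child_ctx :: "ctx \<Rightarrow> seq \<Rightarrow> ctx" where
  "child_ctx \<Gamma> \<Lambda> \<equiv> inbox (plus_ctx \<Gamma> \<Lambda>) 0"

lemma node_root: "node \<Delta> (Hole 0) \<Delta>"
  by (simp add: node_def)

lemma node_child: "node \<Delta> \<Gamma> (\<Lambda> + bx M) \<Longrightarrow> node \<Delta> (child_ctx \<Gamma> \<Lambda>) M"
  by (simp add: node_def)

lemma node_parent:
  assumes "node \<Delta> \<Gamma> M" "depth \<Gamma> > 0"
  obtains \<Gamma>' \<Lambda> where "\<Gamma> = child_ctx \<Gamma>' \<Lambda>" "node \<Delta> \<Gamma>' (\<Lambda> + bx M)"
proof -
  have "\<exists>\<Gamma>' \<Lambda>. at_hole \<Gamma>' = 0 \<and> \<Gamma> = child_ctx \<Gamma>' \<Lambda>" if "at_hole \<Gamma> = 0" "depth \<Gamma> > 0" for \<Gamma>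
    using that
  proof (induction \<Gamma>)
    case (Under \<Lambda> \<Gamma>)
    show ?case
    proof (cases "depth \<Gamma>")
      case 0
      with Under.prems show ?thesis
        by (cases \<Gamma>) (auto intro!: exI[of _ "Hole 0"] exI[of _ \<Lambda>])
    next
      case (Suc n)
      then obtain \<Gamma>' \<Lambda>' where "at_hole \<Gamma>' = 0" "\<Gamma> = child_ctx \<Gamma>' \<Lambda>'"
        using Under by auto
      then show ?thesis by (intro exI[of _ "Under \<Lambda> \<Gamma>'"] exI[of _ \<Lambda>']) simp
    qed
  qed simp
  then obtain \<Gamma>' \<Lambda> where "at_hole \<Gamma>' = 0" "\<Gamma> = child_ctx \<Gamma>' \<Lambda>"
    using assms unfolding node_def by blast
  with assms(1) show thesis using that[of \<Gamma>' \<Lambda>] by (simp add: node_def)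
qed

lemma node_inject: "node \<Delta> \<Gamma> N \<Longrightarrow> node \<Delta> \<Gamma> M \<Longrightarrow> N = M"
proof -
  have "fill \<Gamma> N = fill \<Gamma> M \<Longrightarrow> N = M" for N M
    by (induction \<Gamma>) (auto simp: seq_eq_iff)
  then show "node \<Delta> \<Gamma> N \<Longrightarrow> node \<Delta> \<Gamma> M \<Longrightarrow> N = M" by (metis node_def)
qed

lemma node_axiomatic:
  assumes n: "node \<Delta> G N" and p: "Pos p \<in># forms N" "Neg p \<in># forms N"
  shows "axiomatic \<Delta>"
proof -
  obtain K where K: "N = K + fs (Pos p)" using split_form[OF p(1)] by blast
  then obtain J where "K = J + fs (Neg p)" using split_form[of "Neg p" K] p(2) by auto
  then have "\<Delta> = fill (plus_ctx G J) (fs (Pos p) + fs (Neg p))"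
    using K n by (simp add: node_def ac_simps)
  then show ?thesis unfolding axiomatic_def by blast
qed

text \<open>If the two nodes lie below equal children of a node, they may be taken to lie below the same
  child, as equal children are exchanged by an automorphism.\<close>

lemma two_nodes:
  assumes "node \<Delta> G N" "node \<Delta> G' N'" "A \<in># forms N"
  shows "\<exists>C. outer (fill2nd C 0) = G \<and> (\<forall>b. fill2 C (fs A) b = fill G' (N' + b))"
proof -
  have "at_hole G = 0 \<Longrightarrow> at_hole G' = 0 \<Longrightarrow> fill G N = fill G' N' \<Longrightarrow> ?thesis"
  proof (induction G arbitrary: G')
    case (Hole \<Lambda>)
    then have \<Lambda>: "\<Lambda> = 0" by simp
    show ?case
    proof (cases G')
      case (Hole \<Lambda>')
      obtain K where "N = K + fs A" using split_form[OF assms(3)] by blast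
      then show ?thesis using Hole.prems \<Lambda> Hole
        by (intro exI[of _ "Holes K"]) (auto simp: fill2_def ac_simps)
    next
      case (Under \<Lambda>' G2)
      then have N: "N = \<Lambda>' + bx (fill G2 N')" using Hole.prems \<Lambda> by simp
      then obtain K where "\<Lambda>' = K + fs A" using split_form[of A \<Lambda>'] assms(3) by auto
      then show ?thesis using Hole.prems \<Lambda> Under
        by (intro exI[of _ "First K (plus_ctx G2 N')"]) (auto simp: fill2_def ac_simps)
    qed
  next
    case (Under \<Lambda> G1)
    obtain K where K: "N = K + fs A" using split_form[OF assms(3)] by blast
    have G1: "at_hole G1 = 0" using Under.prems by simp
    show ?case
    proof (cases G')
      case (Hole \<Lambda>')
      then show ?thesis using Under.prems G1 K
        by (intro exI[of _ "Second \<Lambda> (plus_ctx G1 K)"]) (auto simp: fill2_def ac_simps outer_ident)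
    next
      case U: (Under \<Lambda>' G2)
      have eq: "\<Lambda> + bx (fill G1 N) = \<Lambda>' + bx (fill G2 N')" and G2: "at_hole G2 = 0"
        using Under.prems U by simp_all
      show ?thesis
      proof (cases "fill G1 N = fill G2 N'")
        \<comment> \<open>Cancelling the equal children leaves equal surroundings, even if the two
          nodes came from different copies; one copy then hosts both holes.\<close>
        case True
        then have "\<Lambda> = \<Lambda>'" using eq unfolding seq_eq_iff[of "_ + _"] seq_eq_iff[of \<Lambda>] by simp
        moreover obtain C where "outer (fill2nd C 0) = G1" "\<forall>b. fill2 C (fs A) b = fill G2 (N' + b)"
          using Under.IH[OF G1 G2 True] by blast
        ultimately show ?thesis using U
          by (intro exI[of _ "Under2 \<Lambda> C"]) (auto simp: fill2_def)
      next
        case False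
        \<comment> \<open>Distinct children occur side by side, so each lies in the surroundings of
          the other and \<open>Split\<close> applies.\<close>
        then have "fill G2 N' \<in># children \<Lambda>" using eq by (auto simp: seq_eq_iff add_eq_conv_ex)
        then obtain J where J: "\<Lambda> = J + bx (fill G2 N')" using split_child by blast
        then have "\<Lambda>' = J + bx (fill G1 N)" using eq by (auto simp: seq_eq_iff)
        then show ?thesis using U J G1 K
          by (intro exI[of _ "Split J (plus_ctx G1 K) (plus_ctx G2 N')"])
            (auto simp: fill2_def ac_simps outer_ident)
      qed
    qed
  qed
  then show ?thesis using assms unfolding node_def by metis
qed


section \<open>Propagation of formulas\<close>

text \<open>The common form of the five rules by which a diamond adds a single formula to an
  existing node. \<open>G\<close> is the node of the principal formula, the one that finishedness
  speaks of; \<open>G'\<close> receives \<open>F\<close>. The facts below serve both finished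
  sequents and the limit.\<close>

definition propagates :: "axm set \<Rightarrow> seq \<Rightarrow> ctx \<Rightarrow> ctx \<Rightarrow> fm \<Rightarrow> bool" where
  "propagates X \<Delta> G G' F \<longleftrightarrow>
     (\<exists>\<rho>\<in>{RDiaK, RDia AxT, RDia AxB, RDia Ax4, RDia Ax5} \<inter> KX X. \<exists>\<Gamma> N.
        outer \<Gamma> = G \<and> node \<Delta> G' N \<and> inst \<rho> \<Gamma> [fill G' (N + fs F)] \<Delta>)"

lemma propagates_child:
  assumes n: "node \<Delta> G (\<Lambda> + bx M)" and A: "Dia A \<in># forms \<Lambda>"
  shows "propagates X \<Delta> G (child_ctx G \<Lambda>) A"
    and "Ax4 \<in> X \<Longrightarrow> propagates X \<Delta> G (child_ctx G \<Lambda>) (Dia A)"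
proof -
  obtain K where K: "\<Lambda> = K + fs (Dia A)" using split_form[OF A] by blast
  have G: "at_hole G = 0" "\<Delta> = fill (plus_ctx G K) (fs (Dia A) + bx M)"
    using n K by (simp_all add: node_def ac_simps)
  have p: "fill (child_ctx G \<Lambda>) (M + fs F) = fill (plus_ctx G K) (fs (Dia A) + bx (M + fs F))" for F
    by (simp add: K ac_simps)
  have m: "node \<Delta> (child_ctx G \<Lambda>) M" using node_child[OF n] .
  have "inst RDiaK (plus_ctx (plus_ctx G K) (bx M)) [fill (child_ctx G \<Lambda>) (M + fs A)] \<Delta>"
    unfolding p G(2) by (rule inst.intros)
  then show "propagates X \<Delta> G (child_ctx G \<Lambda>) A"
    unfolding propagates_def using m G(1)
    by (intro bexI[of _ RDiaK] exI[of _ "plus_ctx (plus_ctx G K) (bx M)"] exI[of _ M])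
      (auto simp: KX_def outer_ident)
  have "inst (RDia Ax4) (plus_ctx (plus_ctx G K) (bx M)) [fill (child_ctx G \<Lambda>) (M + fs (Dia A))] \<Delta>"
    unfolding p G(2) by (rule inst.intros)
  then show "propagates X \<Delta> G (child_ctx G \<Lambda>) (Dia A)" if "Ax4 \<in> X"
    unfolding propagates_def using m G(1) that
    by (intro bexI[of _ "RDia Ax4"] exI[of _ "plus_ctx (plus_ctx G K) (bx M)"] exI[of _ M])
      (auto simp: KX_def outer_ident)
qed

lemma propagates_same:
  assumes n: "node \<Delta> G N" and A: "Dia A \<in># forms N" and X: "AxT \<in> X"
  shows "propagates X \<Delta> G G A"
proof -
  obtain K where K: "N = K + fs (Dia A)" using split_form[OF A] by blast
  have G: "at_hole G = 0" "\<Delta> = fill (plus_ctx G K) (fs (Dia A))"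
    using n K by (simp_all add: node_def ac_simps)
  have p: "fill G (N + fs A) = fill (plus_ctx G K) (fs (Dia A) + fs A)"
    by (simp add: K ac_simps)
  have "inst (RDia AxT) (plus_ctx G K) [fill G (N + fs A)] \<Delta>"
    unfolding p G(2) by (rule inst.intros)
  then show ?thesis
    unfolding propagates_def using n G(1) X
    by (intro bexI[of _ "RDia AxT"] exI[of _ "plus_ctx G K"] exI[of _ N])
      (auto simp: KX_def outer_ident)
qed

lemma propagates_parent:
  assumes n: "node \<Delta> G (\<Lambda> + bx M)" and A: "Dia A \<in># forms M" and X: "AxB \<in> X"
  shows "propagates X \<Delta> (child_ctx G \<Lambda>) G A"
proof -
  obtain K where K: "M = K + fs (Dia A)" using split_form[OF A] by blast
  have G: "\<Delta> = fill (plus_ctx G \<Lambda>) (bx (K + fs (Dia A)))"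
    using n K by (simp add: node_def)
  have p: "fill G (\<Lambda> + bx M + fs A) = fill (plus_ctx G \<Lambda>) (bx (K + fs (Dia A)) + fs A)"
    by (simp add: K ac_simps)
  have "inst (RDia AxB) (inbox (plus_ctx G \<Lambda>) K) [fill G (\<Lambda> + bx M + fs A)] \<Delta>"
    unfolding p G by (rule inst.intros)
  then show ?thesis
    unfolding propagates_def using n X
    by (intro bexI[of _ "RDia AxB"] exI[of _ "inbox (plus_ctx G \<Lambda>) K"] exI[of _ "\<Lambda> + bx M"])
      (auto simp: KX_def)
qed

text \<open>\<open>two_nodes\<close> presents source and target as the holes of one binary context.
  The source is the first hole, whose depth rule \<open>5\<close> requires to be positive.\<close>

lemma propagates_everywhere:
  assumes n: "node \<Delta> G N" "depth G > 0" "Dia A \<in># forms N" and n': "node \<Delta> G' N'" and X: "Ax5 \<in> X"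
  shows "propagates X \<Delta> G G' (Dia A)"
proof -
  obtain C where C: "outer (fill2nd C 0) = G" "\<And>b. fill2 C (fs (Dia A)) b = fill G' (N' + b)"
    using two_nodes[OF n(1) n' n(3)] by blast
  have "depth (fill2nd C 0) > 0" using C(1) n(2) by (metis depth_simps(3))
  then have "inst (RDia Ax5) (fill2nd C 0) [fill G' (N' + fs (Dia A))] \<Delta>"
    using inst.intros(9)[of C A] n' by (simp add: C(2) node_def)
  then show ?thesis
    unfolding propagates_def using n' X C(1)
    by (intro bexI[of _ "RDia Ax5"] exI[of _ "fill2nd C 0"] exI[of _ N']) (auto simp: KX_def)
qed


section \<open>Finished sequents\<close>

lemma set_seq_forms:
  assumes "set_seq \<Delta> = set_seq \<Lambda>"
  shows "set_mset (forms \<Delta>) = set_mset (forms \<Lambda>)" "set_seq ` set_mset (children \<Delta>) = set_seq ` set_mset (children \<Lambda>)"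
  using assms by (cases \<Delta>; cases \<Lambda>; simp add: Abs_fset_inject)+

text \<open>This is where the comparison at every node pays off: a blocked rule reveals the set
  sequent at the very node it acts on.\<close>

lemma not_set_different:
  assumes "\<not> set_different (fill G N') \<Delta>" "node \<Delta> G N"
  shows "set_seq N' = set_seq N"
  using assms unfolding set_different_def node_def by blast

lemma node_finishedD:
  assumes "node_finished S \<Delta> G" "\<rho> \<in> S" "circ_inst \<rho> \<Gamma> ps \<Delta>" "outer \<Gamma> = G"
  shows "\<exists>p\<in>set ps. \<not> set_different p \<Delta>"
  using assms unfolding node_finished_def circ_def by blast

text \<open>The circled rule keeps its principal formula, so each premise just adds a component to
  the node. Only an unchanged set sequent can block the rule, hence a component was there before.
  The next lemmas follow this pattern.\<close>

lemma finished_And: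
  assumes fin: "node_finished S \<Delta> G" "RAnd \<in> S" and n: "node \<Delta> G N" and A: "And A B \<in># forms N"
  shows "A \<in># forms N \<or> B \<in># forms N"
proof -
  obtain K where K: "N = K + fs (And A B)" using split_form[OF A] by blast
  have G: "at_hole G = 0" "\<Delta> = fill (plus_ctx G K) (fs (And A B))"
    using n K by (simp_all add: node_def)
  have "circ_inst RAnd (plus_ctx G K) [fill G (N + fs A), fill G (N + fs B)] \<Delta>"
    using circ_inst.intros(1)[of "plus_ctx G K" A B] G(2) K by (simp add: ac_simps)
  from node_finishedD[OF fin this] consider "\<not> set_different (fill G (N + fs A)) \<Delta>" | "\<not> set_different (fill G (N + fs B)) \<Delta>"
    using G(1) by (auto simp: outer_ident)
  then show ?thesis
    by cases (drule not_set_different[OF _ n], drule set_seq_forms(1), force)+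
qed

lemma finished_Or:
  assumes fin: "node_finished S \<Delta> G" "ROr \<in> S" and n: "node \<Delta> G N" and A: "Or A B \<in># forms N"
  shows "A \<in># forms N \<and> B \<in># forms N"
proof -
  obtain K where K: "N = K + fs (Or A B)" using split_form[OF A] by blast
  have G: "at_hole G = 0" "\<Delta> = fill (plus_ctx G K) (fs (Or A B))"
    using n K by (simp_all add: node_def)
  have "circ_inst ROr (plus_ctx G K) [fill G (N + fs A + fs B)] \<Delta>"
    using circ_inst.intros(2)[of "plus_ctx G K" A B] G(2) K by (simp add: ac_simps)
  from node_finishedD[OF fin this] have "\<not> set_different (fill G (N + fs A + fs B)) \<Delta>"
    using G(1) by (auto simp: outer_ident)
  then show ?thesis
    by (drule_tac not_set_different[OF _ n], drule_tac set_seq_forms(1), force)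
qed

text \<open>The rule is blocked either by its proviso, which is the claim, or by an unchanged set
  sequent. In the latter case some child has the set sequent of \<open>fs A\<close> and so contains
  \<open>A\<close>.\<close>

lemma finished_Box:
  assumes fin: "node_finished S \<Delta> G" "RBox \<in> S" and n: "node \<Delta> G N" and A: "Box A \<in># forms N"
  shows "\<exists>M\<in>#children N. A \<in># forms M"
proof (rule ccontr)
  assume no: "\<not> ?thesis"
  obtain K where K: "N = K + fs (Box A)" using split_form[OF A] by blast
  have G: "at_hole G = 0" "\<Delta> = fill (plus_ctx G K) (fs (Box A))"
    using n K by (simp_all add: node_def)
  have "circ_inst RBox (plus_ctx G K) [fill G (N + bx (fs A))] \<Delta>"
    using circ_inst.intros(3)[of "plus_ctx G K" A] G no K by (simp add: ac_simps)
  from node_finishedD[OF fin this] have "\<not> set_different (fill G (N + bx (fs A))) \<Delta>"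
    using G(1) by (auto simp: outer_ident)
  then have "set_seq ` set_mset (children (N + bx (fs A))) = set_seq ` set_mset (children N)"
    using not_set_different[OF _ n] set_seq_forms(2) by blast
  then have "set_seq (fs A) \<in> set_seq ` set_mset (children N)" by auto
  then obtain M where "M \<in># children N" "set_seq (fs A) = set_seq M" by blast
  then show False using no set_seq_forms(1)[of "fs A" M] by force
qed

lemma finished_D:
  assumes fin: "node_finished S \<Delta> G" "RDia AxD \<in> S" and n: "node \<Delta> G N" and A: "Dia A \<in># forms N"
  shows "children N \<noteq> {#}"
proof
  assume no: "children N = {#}"
  obtain K where K: "N = K + fs (Dia A)" using split_form[OF A] by blast
  have G: "at_hole G = 0" "\<Delta> = fill (plus_ctx G K) (fs (Dia A))"
    using n K by (simp_all add: node_def)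
  have "circ_inst (RDia AxD) (plus_ctx G K) [fill G (N + bx (fs A))] \<Delta>"
    using circ_inst.intros(4)[of "plus_ctx G K" A] G no K by (simp add: ac_simps)
  from node_finishedD[OF fin this] have "\<not> set_different (fill G (N + bx (fs A))) \<Delta>"
    using G(1) by (auto simp: outer_ident)
  then have "set_seq ` set_mset (children (N + bx (fs A))) = set_seq ` set_mset (children N)"
    using not_set_different[OF _ n] set_seq_forms(2) by blast
  then show False using no by simp
qed

text \<open>Finishedness of the source \<open>G\<close> puts the formula into the target
  \<open>G'\<close>. It is only asked for the rules of step 1, so that cyclic leaves are covered as
  sources.\<close>

lemma finished_propagates:
  assumes fin: "node_finished (step1_rules X) \<Delta> G" and p: "propagates X \<Delta> G G' F" and n: "node \<Delta> G' N"
  shows "F \<in># forms N"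
proof -
  obtain \<rho> \<Gamma> where \<rho>: "\<rho> \<in> {RDiaK, RDia AxT, RDia AxB, RDia Ax4, RDia Ax5} \<inter> KX X"
    and i: "outer \<Gamma> = G" "inst \<rho> \<Gamma> [fill G' (N + fs F)] \<Delta>"
    using p node_inject[OF n] unfolding propagates_def by blast
  have "circ_inst \<rho> \<Gamma> [fill G' (N + fs F)] \<Delta>" "\<rho> \<in> step1_rules X"
    using \<rho> i(2) by (auto intro: circ_inst.intros(5) simp: step1_rules_def)
  from node_finishedD[OF fin this(2,1) i(1)] have "\<not> set_different (fill G' (N + fs F)) \<Delta>"
    by simp
  then show ?thesis
    by (drule_tac not_set_different[OF _ n], drule_tac set_seq_forms(1), force)
qed

section \<open>A finite model from a finished sequent\<close>

lemma finite_nodes: "finite {N. \<exists>G. node \<Delta> G N}"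
proof (induction \<Delta>)
  case (Seq As Ds)
  have "{N. \<exists>G. node (Seq As Ds) G N} \<subseteq> {Seq As Ds} \<union> (\<Union>D\<in>set_mset Ds. {N. \<exists>G. node D G N})"
  proof clarsimp
    fix G N assume n: "node (Seq As Ds) G N" and ne: "\<forall>D\<in>#Ds. \<forall>G. \<not> node D G N"
    then show "N = Seq As Ds"
    proof (cases G)
      case (Under \<Lambda> G')
      then have "fill G' N \<in># children (Seq As Ds)" "at_hole G' = 0"
        using n by (simp_all add: node_def del: seq.sel)
      then show ?thesis using ne by (auto simp: node_def)
    qed (simp add: node_def)
  qed
  moreover have "finite (\<Union>D\<in>set_mset Ds. {N. \<exists>G. node D G N})" using Seq by simp
  ultimately show ?case by (meson finite.emptyI finite.insertI finite_UnI finite_subset)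
qed

text \<open>Taking the sets of formulas as worlds identifies a cyclic leaf with the inner node that
  carries the same formulas.\<close>

lemma finished_hintikka:
  assumes fin: "finished X \<Delta>" and ax: "\<not> axiomatic \<Delta>"
  defines "lb \<equiv> \<lambda>N. set_mset (forms N)"
  shows "hintikka X id {lb N | G N. node \<Delta> G N} (lb \<Delta>) {lb N | G N. node \<Delta> G N \<and> depth G > 0}
    {(lb N, lb M) | G N M. node \<Delta> G N \<and> M \<in># children N}"
    (is "hintikka X id ?W ?r ?N ?E")
proof -
  have f1: "node_finished (step1_rules X) \<Delta> G" if "node \<Delta> G N" for G N
    using fin that unfolding finished_def node_finished_def step1_rules_def by blast
  \<comment> \<open>A cyclic leaf shares its formulas with an inner node. The latter has children,
    so it cannot be cyclic itself and is finished for all rules.\<close>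
  have inner: "\<exists>G' N'. node \<Delta> G' N' \<and> lb N' = lb N \<and> node_finished (KX X) \<Delta> G'" if n: "node \<Delta> G N" for G N
  proof (cases "node_finished (KX X) \<Delta> G")
    case False
    then have "cyclic \<Delta> N" using fin n unfolding finished_def by blast
    then obtain G' M where M: "node \<Delta> G' M" "children M \<noteq> {#}" "lb M = lb N"
      unfolding cyclic_def lb_def by blast
    then have "node_finished (KX X) \<Delta> G'"
      using fin unfolding finished_def cyclic_def by blast
    then show ?thesis using M by blast
  qed (use n in blast)
  have child: "\<exists>G' \<Lambda>. G' = child_ctx G \<Lambda> \<and> N = \<Lambda> + bx M \<and> node \<Delta> G' M" if "node \<Delta> G N" "M \<in># children N" for G N M
    using split_child[OF that(2)] node_child that(1) by blast
  have S: "RAnd \<in> step1_rules X" "ROr \<in> step1_rules X" "RBox \<in> KX X"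
    by (simp_all add: step1_rules_def KX_def)
  show ?thesis
  proof (unfold_locales; (unfold id_apply)?)
    have "lb N \<in> insert ?r ?N" if "node \<Delta> G N" for G N
    proof (cases G)
      case (Hole \<Lambda>)
      then show ?thesis using that by (simp add: node_def)
    next
      case (Under \<Lambda> G')
      then have "depth G > 0" by simp
      then show ?thesis using that by blast
    qed
    then show "?W = insert ?r ?N" using node_root by blast
    show "?E \<subseteq> ?W \<times> ?N"
      using child by fastforce
    show "?N \<subseteq> Range ?E"
    proof
      fix x assume "x \<in> ?N"
      then obtain G M where x: "x = lb M" "node \<Delta> G M" "depth G > 0" by blast
      from node_parent[OF this(2,3)] obtain G' \<Lambda> where "node \<Delta> G' (\<Lambda> + bx M)" by blast
      moreover have "M \<in># children (\<Lambda> + bx M)" by simp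
      ultimately have "(lb (\<Lambda> + bx M), x) \<in> ?E" using x(1) by blast
      then show "x \<in> Range ?E" by blast
    qed
    show "?r \<in> Domain ?E" if ne: "?N \<noteq> {}"
    proof -
      obtain G M where n: "node \<Delta> G M" "depth G > 0" using ne by blast
      then obtain \<Lambda> G' where "G = Under \<Lambda> G'" by (cases G) auto
      then have "fill G' M \<in># children \<Delta>" using n(1) by (simp add: node_def)
      then show ?thesis using node_root by blast
    qed
    show "A \<in> v" if E: "(w, v) \<in> ?E" and A: "Dia A \<in> w" for w v A
    proof -
      obtain G N M where w: "w = lb N" "v = lb M" "node \<Delta> G N" "M \<in># children N"
        using E by blast
      obtain \<Lambda> where c: "N = \<Lambda> + bx M" "node \<Delta> (child_ctx G \<Lambda>) M" using child[OF w(3,4)] by blast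
      have "Dia A \<in># forms \<Lambda>" using A w(1) c(1) by (simp add: lb_def)
      then show ?thesis
        using finished_propagates[OF f1[OF w(3)] propagates_child(1) c(2)] w c by (simp add: lb_def)
    qed
    show "Dia A \<in> v" if X: "Ax4 \<in> X" and E: "(w, v) \<in> ?E" and A: "Dia A \<in> w" for w v A
    proof -
      obtain G N M where w: "w = lb N" "v = lb M" "node \<Delta> G N" "M \<in># children N"
        using E by blast
      obtain \<Lambda> where c: "N = \<Lambda> + bx M" "node \<Delta> (child_ctx G \<Lambda>) M" using child[OF w(3,4)] by blast
      have "Dia A \<in># forms \<Lambda>" using A w(1) c(1) by (simp add: lb_def)
      then show ?thesis
        using finished_propagates[OF f1[OF w(3)] propagates_child(2) c(2)] w c X by (simp add: lb_def)
    qed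
    show "A \<in> w" if X: "AxB \<in> X" and E: "(w, v) \<in> ?E" and A: "Dia A \<in> v" for w v A
    proof -
      obtain G N M where w: "w = lb N" "v = lb M" "node \<Delta> G N" "M \<in># children N"
        using E by blast
      obtain \<Lambda> where c: "N = \<Lambda> + bx M" "node \<Delta> (child_ctx G \<Lambda>) M" using child[OF w(3,4)] by blast
      show ?thesis
        using finished_propagates[OF f1[OF c(2)] propagates_parent w(3)] w c X A by (simp add: lb_def)
    qed
    show "Dia A \<in> w" if X: "Ax5 \<in> X" and v: "v \<in> ?N" and w: "w \<in> ?W" and A: "Dia A \<in> v" for w v A
    proof -
      obtain G M where v: "v = lb M" "node \<Delta> G M" "depth G > 0" using v by blast
      obtain G' N where w: "w = lb N" "node \<Delta> G' N" using w by blast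
      show ?thesis
        using finished_propagates[OF f1[OF v(2)] propagates_everywhere[OF v(2,3)] w(2)] v w X A
        by (simp add: lb_def)
    qed
    fix w assume "w \<in> ?W"
    then obtain G N where w: "w = lb N" "node \<Delta> G N" by blast
    \<comment> \<open>The conditions that demand a successor are read off the twin
      \<open>N'\<close>, the others off the given node \<open>N\<close>.\<close>
    obtain G' N' where i: "node \<Delta> G' N'" "lb N' = w" "node_finished (KX X) \<Delta> G'"
      using inner[OF w(2)] w(1) by blast
    show "Neg p \<notin> w" if "Pos p \<in> w" for p
      using node_axiomatic[OF w(2)] w(1) that ax by (auto simp: lb_def)
    show "A \<in> w \<or> B \<in> w" if "And A B \<in> w" for A B
      using finished_And[OF f1[OF w(2)] S(1) w(2), of A B] w(1) that by (simp add: lb_def)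
    show "A \<in> w \<and> B \<in> w" if "Or A B \<in> w" for A B
      using finished_Or[OF f1[OF w(2)] S(2) w(2), of A B] w(1) that by (simp add: lb_def)
    show "\<exists>v. (w, v) \<in> ?E \<and> A \<in> v" if A: "Box A \<in> w" for A
    proof -
      obtain M where "M \<in># children N'" "A \<in> lb M"
        using finished_Box[OF i(3) S(3) i(1)] i(2) A by (auto simp: lb_def)
      then show ?thesis using i by blast
    qed
    show "w \<in> Domain ?E" if X: "AxD \<in> X" and A: "Dia A \<in> w" for A
    proof -
      have "RDia AxD \<in> KX X" using X by (simp add: KX_def)
      then obtain M where "M \<in># children N'"
        using finished_D[OF i(3) _ i(1)] i(2) A by (auto simp: lb_def)
      then show ?thesis using i by blast
    qed
    show "A \<in> w" if "AxT \<in> X" "Dia A \<in> w" for A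
      using finished_propagates[OF f1[OF w(2)] propagates_same[OF w(2)] w(2)] w(1) that
      by (simp add: lb_def)
  qed
qed

lemma finished_countermodel:
  assumes fin: "finished X \<Delta>" "\<not> axiomatic \<Delta>" and c: "closed45 X"
  shows "\<exists>(W::nat set) R V. finite W \<and> X_frame X W R \<and> (\<exists>w\<in>W. \<not> holds R V w \<Delta>)"
proof -
  define lb where "lb N = set_mset (forms N)" for N
  let ?W = "{lb N | G N. node \<Delta> G N}" and ?E = "{(lb N, lb M) | G N M. node \<Delta> G N \<and> M \<in># children N}"
  have "?W = lb ` {N. \<exists>G. node \<Delta> G N}" by blast
  then have finW: "finite ?W" using finite_nodes by simp
  then obtain f :: "fm set \<Rightarrow> nat" where inj: "inj_on f ?W"
    by (meson finite_imp_inj_to_nat_seg)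
  have h: "hintikka X id ?W (lb \<Delta>) {lb N | G N. node \<Delta> G N \<and> depth G > 0} ?E"
    using finished_hintikka[OF fin] unfolding lb_def .
  obtain R V where R: "X_frame X (f ` ?W) R" "\<forall>w v. (w, v) \<in> ?E \<longrightarrow> (f w, f v) \<in> R"
    "\<forall>w\<in>?W. \<forall>A\<in>id w. \<not> sat R V (f w) A"
    using hintikka.countermodel[OF h c inj] by (elim exE conjE)
  \<comment> \<open>All nodes are refuted by one induction: a boxed subsequent is refuted through
    the world of the corresponding child, which is reached by an edge of \<open>?E\<close>.\<close>
  have "\<not> holds R V (f (lb N)) N" if "node \<Delta> G N" for G N
    using that
  proof (induction N arbitrary: G)
    case (Seq As Ds)
    let ?N = "Seq As Ds"
    have "\<not> sat R V (f (lb ?N)) A" if "A \<in># As" for A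
    proof -
      have "A \<in> id (lb ?N)" using that by (simp add: lb_def)
      then show ?thesis using R(3) Seq.prems by blast
    qed
    moreover have "\<exists>v. (f (lb ?N), v) \<in> R \<and> \<not> holds R V v D" if D: "D \<in># Ds" for D
    proof -
      have D': "D \<in># children ?N" using D by simp
      then obtain \<Lambda> where "?N = \<Lambda> + bx D" using split_child by blast
      then have "node \<Delta> (child_ctx G \<Lambda>) D" using node_child Seq.prems by metis
      moreover have "(lb ?N, lb D) \<in> ?E" using Seq.prems D' by blast
      ultimately show ?thesis using Seq.IH[OF D] R(2) by blast
    qed
    ultimately show ?case by (auto simp: holds_Seq)
  qed
  then have "\<not> holds R V (f (lb \<Delta>)) \<Delta>" using node_root by blast
  moreover have "f (lb \<Delta>) \<in> f ` ?W" using node_root by blast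
  ultimately show ?thesis using R(1) finW by blast
qed


section \<open>The procedure\<close>

text \<open>Pointwise and for every relation, so that it passes through the boxes of a context; the
  worlds are those of the final countermodel.\<close>

definition entails :: "seq \<Rightarrow> seq \<Rightarrow> bool" where
  "entails \<Delta> \<Lambda> \<longleftrightarrow> (\<forall>(R :: (nat \<times> nat) set) V w. holds R V w \<Delta> \<longrightarrow> holds R V w \<Lambda>)"

lemma entails_refl: "entails \<Delta> \<Delta>"
  by (simp add: entails_def)

lemma entails_trans: "entails \<Delta> \<Lambda> \<Longrightarrow> entails \<Lambda> \<Theta> \<Longrightarrow> entails \<Delta> \<Theta>"
  by (simp add: entails_def)

lemma holds_zero [simp]: "\<not> holds R V w 0"
  by (simp add: zero_seq_def holds_Seq)

lemma entails_fill: "entails \<Delta> \<Lambda> \<Longrightarrow> entails (fill \<Gamma> \<Delta>) (fill \<Gamma> \<Lambda>)"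
  unfolding entails_def by (blast intro: holds_fill_mono)

text \<open>The empty sequent is false everywhere, and disjunctions and boxes are monotone.\<close>

lemma entails_fill2: "entails (fill2 \<Gamma> \<Delta> 0) (fill2 \<Gamma> \<Delta> \<Lambda>)"
  unfolding entails_def
proof (intro allI impI)
  fix R :: "(nat \<times> nat) set" and V w
  show "holds R V w (fill2 \<Gamma> \<Delta> 0) \<Longrightarrow> holds R V w (fill2 \<Gamma> \<Delta> \<Lambda>)"
    by (induction \<Gamma> arbitrary: w) (auto simp: fill2_def intro: holds_fill_mono[of R V 0])
qed

lemma inst_entails:
  assumes "inst \<rho> \<Gamma> ps c" "\<rho> \<notin> {RAnd, ROr, RBox}" "p \<in> set ps"
  shows "entails c p"
  using assms by cases (auto intro!: entails_fill entails_fill2 simp: entails_def[of "_ + _"] entails_def[of "fs _"] entails_def[of "bx _"])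

lemma circ_entails:
  assumes "circ \<rho> \<Gamma> ps c" "p \<in> set ps"
  shows "entails c p"
proof -
  have "circ_inst \<rho> \<Gamma> ps c" using assms(1) by (simp add: circ_def)
  then show ?thesis
  proof cases
    case 5
    then show ?thesis using inst_entails[OF _ _ assms(2)] by blast
  qed (use assms(2) in \<open>auto intro!: entails_fill simp: entails_def[of "fs _"]\<close>)
qed

lemma rel_mset_left: "rel_mset P M M' \<Longrightarrow> x \<in># M \<Longrightarrow> \<exists>y\<in>#M'. P x y"
  by (metis insert_DiffM msed_rel_invL union_single_eq_member)

lemma rel_mset_right: "rel_mset P M M' \<Longrightarrow> y \<in># M' \<Longrightarrow> \<exists>x\<in>#M. P x y"
  by (metis insert_DiffM msed_rel_invR union_single_eq_member)

lemma pass_entails: "pass X \<Delta> \<Delta>' \<Longrightarrow> entails \<Delta> \<Delta>'"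
proof (induction rule: pass.induct)
  case (1 Ds Ds' As \<Delta>)
  have "entails (Seq As Ds) (Seq As Ds')"
    using rel_mset_left[OF 1(1)] unfolding entails_def holds_Seq by meson
  moreover have "entails (Seq As Ds') \<Delta>"
    using 1(2)
  proof induction
    case (step \<Delta> \<Delta>')
    then have "entails \<Delta> \<Delta>'"
      unfolding step2_at_root_def by (auto dest: circ_entails)
    with step.IH show ?case by (rule entails_trans)
  qed (rule entails_refl)
  ultimately show ?case by (rule entails_trans)
qed

lemma step1_entails: "step1 X M M' \<Longrightarrow> \<forall>\<Delta>\<in>#M. entails \<Gamma> \<Delta> \<Longrightarrow> \<forall>\<Delta>\<in>#M'. entails \<Gamma> \<Delta>"
  by (erule step1.cases) (auto dest: circ_entails entails_trans)

lemma phase1_entails: "phase1 X M M' \<Longrightarrow> \<forall>\<Delta>\<in>#M. entails \<Gamma> \<Delta> \<Longrightarrow> \<forall>\<Delta>\<in>#M'. entails \<Gamma> \<Delta>"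
proof -
  have "(step1 X)\<^sup>*\<^sup>* M M' \<Longrightarrow> \<forall>\<Delta>\<in>#M. entails \<Gamma> \<Delta> \<Longrightarrow> \<forall>\<Delta>\<in>#M'. entails \<Gamma> \<Delta>"
    by (induction rule: rtranclp_induct) (auto dest: step1_entails)
  then show "phase1 X M M' \<Longrightarrow> \<forall>\<Delta>\<in>#M. entails \<Gamma> \<Delta> \<Longrightarrow> \<forall>\<Delta>\<in>#M'. entails \<Gamma> \<Delta>"
    by (simp add: phase1_def)
qed

lemma phase2_entails:
  assumes "phase2 X M M'" "\<forall>\<Delta>\<in>#M. entails \<Gamma> \<Delta>"
  shows "\<forall>\<Delta>\<in>#M'. entails \<Gamma> \<Delta>"
proof
  fix \<Delta>' assume "\<Delta>' \<in># M'"
  then obtain \<Delta> where "\<Delta> \<in># M" "if unfinished X \<Delta> then pass X \<Delta> \<Delta>' else \<Delta>' = \<Delta>"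
    using rel_mset_right[OF assms(1)[unfolded phase2_def]] by blast
  then show "entails \<Gamma> \<Delta>'"
    using assms(2) by (metis pass_entails entails_trans)
qed

lemma repeat_until_entails:
  "repeat_until X M M' \<Longrightarrow> \<forall>\<Delta>\<in>#M. entails \<Gamma> \<Delta> \<Longrightarrow> \<forall>\<Delta>\<in>#M'. entails \<Gamma> \<Delta> \<and> \<not> unfinished X \<Delta>"
proof (induction rule: repeat_until.induct)
  case (stop M M1 M2)
  then show ?case using phase1_entails phase2_entails by blast
next
  case (loop M M1 M2 M3)
  then show ?case using phase1_entails phase2_entails by blast
qed

lemma prove_fails_countermodel:
  assumes "prove_fails \<Gamma> X" "closed45 X"
  shows "\<exists>(W::nat set) R. finite W \<and> X_frame X W R \<and> \<not> valid_in W R \<Gamma>"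
proof -
  obtain M \<Delta> where M: "repeat_until X {#\<Gamma>#} M" "\<Delta> \<in># M" "\<not> axiomatic \<Delta>"
    using assms(1) unfolding prove_fails_def by blast
  then have "entails \<Gamma> \<Delta>" "finished X \<Delta>"
    using repeat_until_entails[OF M(1), of \<Gamma>] by (auto simp: entails_refl unfinished_def)
  then show ?thesis
    using finished_countermodel[OF _ M(3) assms(2)] unfolding valid_in_def entails_def by blast
qed


section \<open>Proof search on ordered trees\<close>

text \<open>Ordered trees give each node an address, a list of child indices, which is kept when the
  tree grows.\<close>

datatype otree = OT (lab: "fm multiset") (kids: "otree list")

primrec seq_of :: "otree \<Rightarrow> seq" where
  "seq_of (OT M ts) = Seq M (mset (map seq_of ts))"

lemma forms_seq_of [simp]: "forms (seq_of t) = lab t"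
  by (cases t) simp

lemma ex_otree: "\<exists>t. seq_of t = \<Delta>"
proof (induction \<Delta>)
  case (Seq M Ds)
  then obtain g where g: "\<And>D. D \<in># Ds \<Longrightarrow> seq_of (g D) = D" by metis
  obtain xs where xs: "mset xs = Ds" using ex_mset by blast
  then have "map (seq_of \<circ> g) xs = xs" using g by (intro map_idI) auto
  then have "seq_of (OT M (map g xs)) = Seq M Ds" using xs by simp
  then show ?case by blast
qed

fun sub :: "otree \<Rightarrow> nat list \<Rightarrow> otree option" where
  "sub t [] = Some t"
| "sub t (i # p) = (if i < length (kids t) then sub (kids t ! i) p else None)"

fun upd :: "otree \<Rightarrow> nat list \<Rightarrow> otree \<Rightarrow> otree" where
  "upd t [] s = s"
| "upd t (i # p) s = OT (lab t) ((kids t)[i := upd (kids t ! i) p s])"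

text \<open>What surrounds the \<open>i\<close>-th child, in the role of \<open>\<Lambda>\<close> in
  \<open>child_ctx\<close>.\<close>

definition rest :: "otree \<Rightarrow> nat \<Rightarrow> seq" where
  "rest t i = Seq (lab t) (mset (map seq_of (take i (kids t) @ drop (Suc i) (kids t))))"

fun addr_ctx :: "otree \<Rightarrow> nat list \<Rightarrow> ctx" where
  "addr_ctx t [] = Hole 0"
| "addr_ctx t (i # p) = Under (rest t i) (addr_ctx (kids t ! i) p)"

lemma forms_rest [simp]: "forms (rest t i) = lab t"
  by (simp add: rest_def)

lemma seq_of_rest:
  assumes "i < length (kids t)"
  shows "seq_of t = rest t i + bx (seq_of (kids t ! i))"
proof -
  have "mset (map seq_of (kids t)) =
      mset (map seq_of (take i (kids t) @ kids t ! i # drop (Suc i) (kids t)))"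
    using id_take_nth_drop[OF assms] by metis
  then show ?thesis by (cases t) (simp add: seq_eq_iff rest_def)
qed

lemma rest_update: "rest (OT (lab t) ((kids t)[i := s])) i = rest t i"
  by (simp add: rest_def)

lemma node_addr: "sub t p = Some s \<Longrightarrow> node (seq_of t) (addr_ctx t p) (seq_of s)"
  by (induction p arbitrary: t) (auto simp: node_def seq_of_rest split: if_splits)

lemma depth_addr_ctx [simp]: "depth (addr_ctx t p) = length p"
  by (induction p arbitrary: t) simp_all

lemma addr_ctx_snoc: "sub t p = Some s \<Longrightarrow> addr_ctx t (p @ [i]) = child_ctx (addr_ctx t p) (rest s i)"
  by (induction p arbitrary: t) (auto split: if_splits)

lemma seq_of_upd: "sub t p = Some s \<Longrightarrow> seq_of (upd t p s') = fill (addr_ctx t p) (seq_of s')"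
proof (induction p arbitrary: t)
  case (Cons i p)
  then have "i < length (kids t)" by (auto split: if_splits)
  then show ?case
    using Cons seq_of_rest[of i "upd t (i # p) s'"] by (simp add: rest_update)
qed simp

lemma sub_upd: "sub t p = Some s \<Longrightarrow> sub (upd t p s') p = Some s'"
  by (induction p arbitrary: t) (auto split: if_splits)

lemma sub_append: "sub t (p @ q) = Option.bind (sub t p) (\<lambda>s. sub s q)"
  by (induction p arbitrary: t) auto

text \<open>The formulas that their rules remove from the premises; literals and diamonds never
  leave a node.\<close>

fun decomposable :: "fm \<Rightarrow> bool" where
  "decomposable (Pos p) = False"
| "decomposable (Neg p) = False"
| "decomposable (Dia A) = False"
| "decomposable _ = True"

text \<open>Only what one backward step achieves in a node and its children. The effect of a diamond
  on existing nodes is left to \<open>propagates\<close>, so that for \<open>Dia\<close> just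
  \<open>d\<close> remains.\<close>

fun reduced :: "axm set \<Rightarrow> fm \<Rightarrow> otree \<Rightarrow> bool" where
  "reduced X (And A B) t \<longleftrightarrow> A \<in># lab t \<or> B \<in># lab t"
| "reduced X (Or A B) t \<longleftrightarrow> A \<in># lab t \<and> B \<in># lab t"
| "reduced X (Box A) t \<longleftrightarrow> (\<exists>k\<in>set (kids t). A \<in># lab k)"
| "reduced X (Dia A) t \<longleftrightarrow> (AxD \<in> X \<longrightarrow> kids t \<noteq> [])"
| "reduced X _ t \<longleftrightarrow> True"

text \<open>The second disjunct covers a principal formula that its rule has consumed.\<close>

inductive ext :: "axm set \<Rightarrow> otree \<Rightarrow> otree \<Rightarrow> bool" for X where
  "length ts \<le> length ts' \<Longrightarrow> \<forall>i<length ts. ext X (ts ! i) (ts' ! i) \<Longrightarrow>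
   \<forall>C\<in>#M. C \<in># M' \<or> decomposable C \<and> reduced X C (OT M' ts') \<Longrightarrow>
   ext X (OT M ts) (OT M' ts')"

lemma ext_refl: "ext X t t"
  by (induction t) (auto intro!: ext.intros)

lemma ext_append:
  "\<forall>C\<in>#lab s. C \<in># M' \<or> decomposable C \<and> reduced X C (OT M' (kids s @ us)) \<Longrightarrow>
   ext X s (OT M' (kids s @ us))"
  by (cases s) (auto intro!: ext.intros simp: nth_append ext_refl)

lemma ext_lab: "ext X s s' \<Longrightarrow> C \<in># lab s \<Longrightarrow> C \<in># lab s' \<or> decomposable C \<and> reduced X C s'"
  by (auto elim!: ext.cases)

lemma ext_sub: "ext X t t' \<Longrightarrow> sub t p = Some s \<Longrightarrow> \<exists>s'. sub t' p = Some s' \<and> ext X s s'"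
proof (induction p arbitrary: t t')
  case (Cons i p)
  from Cons.prems(1) show ?case
  proof cases
    case (1 ts ts' M M')
    then show ?thesis using Cons.prems(2) Cons.IH[of "ts ! i" "ts' ! i"] by (auto split: if_splits)
  qed
qed simp

lemma ext_upd: "sub t p = Some s \<Longrightarrow> ext X s s' \<Longrightarrow> ext X t (upd t p s')"
proof (induction p arbitrary: t)
  case (Cons i p)
  then show ?case
    by (cases t) (auto intro!: ext.intros simp: nth_list_update ext_refl split: if_splits)
qed simp

text \<open>A task asks either that \<open>C\<close> arrive at address \<open>p\<close> or that
  \<open>C\<close> be reduced there. It names the target alone; the source is existential and may
  depend on the current tree. A task that does not apply at present is satisfied vacuously.\<close>

fun stage :: "axm set \<Rightarrow> bool \<times> nat list \<times> fm \<Rightarrow> otree \<Rightarrow> otree \<Rightarrow> bool" where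
  "stage X (b, p, C) t t' \<longleftrightarrow> ext X t t' \<and> (\<forall>s. sub t p = Some s \<longrightarrow> (\<exists>s'. sub t' p = Some s' \<and>
     (if b then (\<exists>G. propagates X (seq_of t) G (addr_ctx t p) C) \<longrightarrow> C \<in># lab s'
      else C \<in># lab s \<longrightarrow> reduced X C s')))"

lemma stage_upd:
  assumes "sub t p = Some s" "ext X s s'"
    and "if b then C \<in># lab s' else reduced X C s'"
  shows "stage X (b, p, C) t (upd t p s')"
  using assms ext_upd sub_upd by (auto split: if_splits)

text \<open>An unprovable conclusion has an unprovable premise, and this premise becomes the next
  tree. If the task does not apply, the tree is kept.\<close>

lemma stage_exists:
  assumes np: "\<not> provable (KX X) (seq_of t)"
  shows "\<exists>t'. \<not> provable (KX X) (seq_of t') \<and> stage X (b, p, C) t t'"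
proof (cases "\<exists>s. sub t p = Some s \<and>
    (if b then \<exists>G. propagates X (seq_of t) G (addr_ctx t p) C else C \<in># lab s)")
  case False
  then have "stage X (b, p, C) t t" by (auto simp: ext_refl split: if_splits)
  with np show ?thesis by blast
next
  case True
  then obtain s where s: "sub t p = Some s"
    and C: "if b then \<exists>G. propagates X (seq_of t) G (addr_ctx t p) C else C \<in># lab s"
    by blast
  let ?G = "addr_ctx t p"
  have n: "node (seq_of t) ?G (seq_of s)" by (rule node_addr[OF s])
  have ex: "\<exists>P\<in>set ps. \<not> provable (KX X) P" if "\<rho> \<in> KX X" "inst \<rho> \<Gamma> ps (seq_of t)" for \<rho> \<Gamma> ps
    using np provable.Rule[OF that] by blast
  have goal: ?thesis
    if "\<not> provable (KX X) (fill ?G (seq_of s'))" "ext X s s'" "if b then C \<in># lab s' else reduced X C s'" for s'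
    using stage_upd[OF s that(2,3)] that(1) seq_of_upd[OF s] by metis
  show ?thesis
  proof (cases b)
    case True
    then obtain G \<rho> \<Gamma> where \<rho>: "\<rho> \<in> KX X" "inst \<rho> \<Gamma> [fill ?G (seq_of s + fs C)] (seq_of t)"
      using C node_inject[OF n] unfolding propagates_def by auto
    let ?s = "OT (add_mset C (lab s)) (kids s @ [])"
    have "seq_of ?s = seq_of s + fs C" by (cases s) (simp add: seq_eq_iff)
    then have "\<not> provable (KX X) (fill ?G (seq_of ?s))" using ex[OF \<rho>] by simp
    moreover have "ext X s ?s" by (rule ext_append) auto
    ultimately show ?thesis using goal[of ?s] True by simp
  next
    case False
    then have C: "C \<in># lab s" using C by simp
    \<comment> \<open>One occurrence of \<open>C\<close> is taken out, as rules act on occurrences;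
      further copies stay in the node.\<close>
    define K where "K = Seq (lab s - {#C#}) (mset (map seq_of (kids s)))"
    have K: "seq_of s = K + fs C" using C by (cases s) (simp add: K_def seq_eq_iff)
    have t: "seq_of t = fill (plus_ctx ?G K) (fs C)" using n K by (simp add: node_def)
    have sq: "seq_of (OT (lab s - {#C#} + M) (kids s @ us)) = K + Seq M (mset (map seq_of us))" for M us
      by (simp add: K_def seq_eq_iff)
    \<comment> \<open>\<open>M\<close> replaces the occurrence of \<open>C\<close>, and
      \<open>us\<close> are the new children. Placed last, they leave all old addresses
      intact.\<close>
    have ext: "ext X s (OT (lab s - {#C#} + M) (kids s @ us))"
      if "C \<in># M \<or> decomposable C \<and> reduced X C (OT (lab s - {#C#} + M) (kids s @ us))" for M us
    proof (rule ext_append, rule ballI)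
      fix C' assume C': "C' \<in># lab s"
      show "C' \<in># lab s - {#C#} + M \<or>
          decomposable C' \<and> reduced X C' (OT (lab s - {#C#} + M) (kids s @ us))"
      proof (cases "C' = C")
        case True
        then show ?thesis using that by (simp only: union_iff) blast
      next
        case False
        then have "C' \<in># lab s - {#C#}" using C' by (simp add: in_diff_count)
        then show ?thesis by (simp only: union_iff simp_thms)
      qed
    qed
    have goal': ?thesis
      if "\<not> provable (KX X) (fill ?G (K + Seq M (mset (map seq_of us))))"
        "C \<in># M \<or> decomposable C" "reduced X C (OT (lab s - {#C#} + M) (kids s @ us))" for M us
      using goal[of "OT (lab s - {#C#} + M) (kids s @ us)"] ext[of M us] sq[of M us] that False by auto
    show ?thesis
    proof (cases C)
      case (Pos q)
      then show ?thesis using goal'[of "{#C#}" "[]"] np t by (simp add: fs_def)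
    next
      case (Neg q)
      then show ?thesis using goal'[of "{#C#}" "[]"] np t by (simp add: fs_def)
    next
      case (Or A B)
      have "\<not> provable (KX X) (fill ?G (K + Seq {#A, B#} {#}))"
        using ex[OF _ inst.intros(2)[of "plus_ctx ?G K" A B, folded t[unfolded Or]]]
        by (simp add: KX_def fs_def plus_seq_def add_mset_commute)
      then show ?thesis using goal'[of "{#A, B#}" "[]"] Or by simp
    next
      case (And A B)
      have "\<not> provable (KX X) (fill ?G (K + Seq {#A#} {#})) \<or> \<not> provable (KX X) (fill ?G (K + Seq {#B#} {#}))"
        using ex[OF _ inst.intros(1)[of "plus_ctx ?G K" A B, folded t[unfolded And]]]
        by (simp add: KX_def fs_def)
      then show ?thesis
      proof
        assume "\<not> provable (KX X) (fill ?G (K + Seq {#A#} {#}))"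
        then show ?thesis using goal'[of "{#A#}" "[]"] And by simp
      next
        assume "\<not> provable (KX X) (fill ?G (K + Seq {#B#} {#}))"
        then show ?thesis using goal'[of "{#B#}" "[]"] And by simp
      qed
    next
      case (Box A)
      have "\<not> provable (KX X) (fill ?G (K + Seq {#} {#Seq {#A#} {#}#}))"
        using ex[OF _ inst.intros(3)[of "plus_ctx ?G K" A, folded t[unfolded Box]]]
        by (simp add: KX_def fs_def bx_def)
      then show ?thesis using goal'[of "{#}" "[OT {#A#} []]"] Box by simp
    next
      case (Dia A)
      show ?thesis
      proof (cases "AxD \<in> X")
        case True
        have "\<not> provable (KX X) (fill ?G (K + Seq {#C#} {#Seq {#A#} {#}#}))"
          using ex[OF _ inst.intros(5)[of "plus_ctx ?G K" A, folded t[unfolded Dia]]] True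
          by (simp add: Dia KX_def fs_def bx_def plus_seq_def)
        then show ?thesis using goal'[of "{#C#}" "[OT {#A#} []]"] Dia by simp
      next
        case False
        then show ?thesis using goal'[of "{#C#}" "[]"] np t Dia by (simp add: fs_def)
      qed
    qed
  qed
qed


section \<open>The limit of a fair run\<close>

instance fm :: countable
  by countable_datatype

text \<open>The second component of the decoded pair makes every task recur beyond any bound, so a
  task that came too early comes up again.\<close>

definition task :: "nat \<Rightarrow> bool \<times> nat list \<times> fm" where
  "task n = from_nat (fst (prod_decode n))"

lemma task_recurs: "\<exists>m\<ge>n. task m = k"
  by (rule exI[of _ "prod_encode (to_nat k, n)"]) (simp add: task_def le_prod_encode_2)

locale run =
  fixes X :: "axm set" and t :: "nat \<Rightarrow> otree"
  assumes unprovable: "\<not> provable (KX X) (seq_of (t n))"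
    and stage: "stage X (task n) (t n) (t (Suc n))"
begin

definition addrs :: "nat list set" where
  "addrs = {p. \<exists>n s. sub (t n) p = Some s}"

definition label :: "nat list \<Rightarrow> fm set" where
  "label p = {C. \<exists>n s. sub (t n) p = Some s \<and> C \<in># lab s}"

lemma ext_Suc: "ext X (t n) (t (Suc n))"
  using stage[of n] by (cases "task n") auto

text \<open>Extensions lose only decomposable formulas. Hence complementary literals of different
  stages meet at a later one, and a diamond is still present when its task is due.\<close>

lemma sub_mono:
  assumes "sub (t n) p = Some s" "n \<le> m"
  shows "\<exists>s'. sub (t m) p = Some s' \<and> (\<forall>C\<in>#lab s. \<not> decomposable C \<longrightarrow> C \<in># lab s')"
  using assms(2)
proof (induction rule: dec_induct)
  case base
  then show ?case using assms(1) by blast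
next
  case (step m)
  then obtain s' where s': "sub (t m) p = Some s'" "\<forall>C\<in>#lab s. \<not> decomposable C \<longrightarrow> C \<in># lab s'"
    by blast
  then obtain s'' where "sub (t (Suc m)) p = Some s''" "ext X s' s''"
    using ext_sub[OF ext_Suc] by blast
  with s'(2) show ?case by (meson ext_lab)
qed

text \<open>When the task for \<open>C\<close> at \<open>p\<close> comes up, either \<open>C\<close>
  is still in the node and gets reduced, or it has disappeared before, and then it was reduced at
  the stage where it did.\<close>

lemma label_reduced:
  assumes "C \<in> label p"
  shows "\<exists>m s. sub (t m) p = Some s \<and> reduced X C s"
proof -
  obtain n s where n: "sub (t n) p = Some s" "C \<in># lab s" using assms unfolding label_def by blast
  obtain m where m: "m \<ge> n" "task m = (False, p, C)" using task_recurs by blast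
  from m(1) have "(\<exists>s. sub (t m) p = Some s \<and> C \<in># lab s) \<or> ?thesis"
  proof (induction rule: dec_induct)
    case base
    then show ?case using n by blast
  next
    case (step m)
    then show ?case by (meson ext_sub[OF ext_Suc] ext_lab)
  qed
  then show ?thesis
    using stage[of m] m(2) by fastforce
qed

text \<open>The premise covers all late stages because the date of the task is not under control.
  The contexts of source and target may change from stage to stage.\<close>

lemma label_propagates:
  assumes "\<And>m. m \<ge> n \<Longrightarrow> \<exists>s G. sub (t m) p = Some s \<and> propagates X (seq_of (t m)) G (addr_ctx (t m) p) F"
  shows "F \<in> label p"
proof -
  obtain m where m: "m \<ge> n" "task m = (True, p, F)" using task_recurs by blast
  with assms[OF m(1)] stage[of m] have "\<exists>s. sub (t (Suc m)) p = Some s \<and> F \<in># lab s"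
    by fastforce
  then show ?thesis unfolding label_def by blast
qed

lemma eventually_Dia:
  assumes "Dia A \<in> label p" "q \<in> addrs"
  shows "\<exists>n. \<forall>m\<ge>n. \<exists>s s'. sub (t m) p = Some s \<and> Dia A \<in># lab s \<and> sub (t m) q = Some s'"
proof -
  obtain n s where n: "sub (t n) p = Some s" "Dia A \<in># lab s" using assms unfolding label_def by blast
  obtain n' s' where n': "sub (t n') q = Some s'" using assms unfolding addrs_def by blast
  have "\<exists>s s'. sub (t m) p = Some s \<and> Dia A \<in># lab s \<and> sub (t m) q = Some s'" if "m \<ge> max n n'" for m
    using sub_mono[OF n(1), of m] sub_mono[OF n', of m] that n(2) by fastforce
  then show ?thesis by blast
qed

lemma sub_snoc: "sub t' (p @ [i]) = Some s' \<longleftrightarrow> (\<exists>s. sub t' p = Some s \<and> i < length (kids s) \<and> s' = kids s ! i)"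
  by (cases "sub t' p") (auto simp: sub_append)

lemma node_child_addr:
  assumes "sub t' p = Some s" "i < length (kids s)"
  shows "node (seq_of t') (addr_ctx t' p) (rest s i + bx (seq_of (kids s ! i)))"
  using node_addr[OF assms(1)] seq_of_rest[OF assms(2)] by simp

text \<open>For the propositional, box and \<open>d\<close> conditions a single stage suffices, as
  labels collect all stages. The remaining diamond conditions need source and target together when
  the task is due, which \<open>eventually_Dia\<close> ensures. Addresses stay distinct even if
  labels coincide, so here the root is outside \<open>?N\<close>.\<close>

lemma hintikka: "hintikka X label addrs [] (addrs - {[]}) {(p, p @ [i]) | p i. p @ [i] \<in> addrs}"
  (is "hintikka X label addrs [] ?N ?E")
proof
  have nil: "[] \<in> addrs" by (simp add: addrs_def)
  have prefix: "p \<in> addrs" if "p @ q \<in> addrs" for p q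
    using that unfolding addrs_def by (auto simp: sub_append bind_eq_Some_conv)
  show "addrs = insert [] ?N" using nil by blast
  show "?E \<subseteq> addrs \<times> ?N" using prefix by auto
  show "?N \<subseteq> Range ?E"
  proof
    fix p assume "p \<in> ?N"
    then show "p \<in> Range ?E" by (cases p rule: rev_cases) auto
  qed
  show "[] \<in> Domain ?E" if ne: "?N \<noteq> {}"
  proof -
    obtain p where "p \<in> addrs" "p \<noteq> []" using ne by blast
    then obtain i q where "[i] @ q \<in> addrs" by (cases p) auto
    then have "[i] \<in> addrs" using prefix by blast
    then show ?thesis by force
  qed
  fix p A
  show "Neg q \<notin> label p" if P: "Pos q \<in> label p" for q
  proof
    assume "Neg q \<in> label p"
    with P obtain n s n' s' where n: "sub (t n) p = Some s" "Pos q \<in># lab s"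
      "sub (t n') p = Some s'" "Neg q \<in># lab s'"
      unfolding label_def by blast
    obtain u where "sub (t (max n n')) p = Some u" "Pos q \<in># lab u" "Neg q \<in># lab u"
      using sub_mono[OF n(1), of "max n n'"] sub_mono[OF n(3), of "max n n'"] n(2,4) by fastforce
    then have "axiomatic (seq_of (t (max n n')))"
      using node_axiomatic[OF node_addr] by simp
    then show False using unprovable provable.Ax by blast
  qed
  show "A \<in> label p \<or> B \<in> label p" if "And A B \<in> label p" for B
    using label_reduced[OF that] unfolding label_def by auto
  show "A \<in> label p \<and> B \<in> label p" if "Or A B \<in> label p" for B
    using label_reduced[OF that] unfolding label_def by auto
  show "\<exists>q. (p, q) \<in> ?E \<and> A \<in> label q" if A: "Box A \<in> label p"
  proof -
    obtain m s where "sub (t m) p = Some s" "reduced X (Box A) s" using label_reduced[OF A] by blast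
    then obtain i where i: "sub (t m) (p @ [i]) = Some (kids s ! i)" "A \<in># lab (kids s ! i)"
      by (auto simp: sub_snoc in_set_conv_nth)
    then have "p @ [i] \<in> addrs" "A \<in> label (p @ [i])" unfolding addrs_def label_def by blast+
    then show ?thesis by blast
  qed
  show "p \<in> Domain ?E" if X: "AxD \<in> X" and A: "Dia A \<in> label p"
  proof -
    obtain m s where "sub (t m) p = Some s" "kids s \<noteq> []" using label_reduced[OF A] X by auto
    then have "sub (t m) (p @ [0]) = Some (kids s ! 0)" by (simp add: sub_snoc)
    then have "p @ [0] \<in> addrs" unfolding addrs_def by blast
    then show ?thesis by blast
  qed
  show "A \<in> label p" if X: "AxT \<in> X" and p: "p \<in> addrs" and A: "Dia A \<in> label p"
  proof -
    obtain n where n: "\<forall>m\<ge>n. \<exists>s s'. sub (t m) p = Some s \<and> Dia A \<in># lab s \<and> sub (t m) p = Some s'"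
      using eventually_Dia[OF A p] by blast
    show ?thesis
    proof (rule label_propagates)
      fix m assume "n \<le> m"
      with n obtain s where "sub (t m) p = Some s" "Dia A \<in># lab s" by blast
      then show "\<exists>s G. sub (t m) p = Some s \<and> propagates X (seq_of (t m)) G (addr_ctx (t m) p) A"
        using propagates_same[OF node_addr] X by fastforce
    qed
  qed
  fix q
  show "A \<in> label q" if E: "(p, q) \<in> ?E" and A: "Dia A \<in> label p"
  proof -
    obtain i where q: "q = p @ [i]" "q \<in> addrs" using E by blast
    obtain n where n: "\<forall>m\<ge>n. \<exists>s s'. sub (t m) p = Some s \<and> Dia A \<in># lab s \<and> sub (t m) q = Some s'"
      using eventually_Dia[OF A q(2)] by blast
    show ?thesis
    proof (rule label_propagates)
      fix m assume "n \<le> m"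
      with n obtain s where "sub (t m) p = Some s" "Dia A \<in># lab s" "i < length (kids s)"
        unfolding q(1) sub_snoc by fastforce
      then show "\<exists>s G. sub (t m) q = Some s \<and> propagates X (seq_of (t m)) G (addr_ctx (t m) q) A"
        using propagates_child(1)[OF node_child_addr] unfolding q(1) sub_snoc
        by (fastforce simp: addr_ctx_snoc)
    qed
  qed
  show "Dia A \<in> label q" if X: "Ax4 \<in> X" and E: "(p, q) \<in> ?E" and A: "Dia A \<in> label p"
  proof -
    obtain i where q: "q = p @ [i]" "q \<in> addrs" using E by blast
    obtain n where n: "\<forall>m\<ge>n. \<exists>s s'. sub (t m) p = Some s \<and> Dia A \<in># lab s \<and> sub (t m) q = Some s'"
      using eventually_Dia[OF A q(2)] by blast
    show ?thesis
    proof (rule label_propagates)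
      fix m assume "n \<le> m"
      with n obtain s where "sub (t m) p = Some s" "Dia A \<in># lab s" "i < length (kids s)"
        unfolding q(1) sub_snoc by fastforce
      then show "\<exists>s G. sub (t m) q = Some s \<and> propagates X (seq_of (t m)) G (addr_ctx (t m) q) (Dia A)"
        using propagates_child(2)[OF node_child_addr] X unfolding q(1) sub_snoc
        by (fastforce simp: addr_ctx_snoc)
    qed
  qed
  show "A \<in> label p" if X: "AxB \<in> X" and E: "(p, q) \<in> ?E" and A: "Dia A \<in> label q"
  proof -
    obtain i where q: "q = p @ [i]" "p \<in> addrs" using E prefix by blast
    obtain n where n: "\<forall>m\<ge>n. \<exists>s s'. sub (t m) q = Some s \<and> Dia A \<in># lab s \<and> sub (t m) p = Some s'"
      using eventually_Dia[OF A q(2)] by blast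
    show ?thesis
    proof (rule label_propagates)
      fix m assume "n \<le> m"
      with n obtain s where "sub (t m) p = Some s" "i < length (kids s)" "Dia A \<in># lab (kids s ! i)"
        unfolding q(1) sub_snoc by fastforce
      then show "\<exists>s G. sub (t m) p = Some s \<and> propagates X (seq_of (t m)) G (addr_ctx (t m) p) A"
        using propagates_parent[OF node_child_addr] X by fastforce
    qed
  qed
  show "Dia A \<in> label p" if X: "Ax5 \<in> X" and q: "q \<in> ?N" and p: "p \<in> addrs" and A: "Dia A \<in> label q"
  proof -
    obtain n where n: "\<forall>m\<ge>n. \<exists>s s'. sub (t m) q = Some s \<and> Dia A \<in># lab s \<and> sub (t m) p = Some s'"
      using eventually_Dia[OF A p] by blast
    show ?thesis
    proof (rule label_propagates)
      fix m assume "n \<le> m"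
      with n obtain s s' where "sub (t m) q = Some s" "Dia A \<in># lab s" "sub (t m) p = Some s'" by blast
      then show "\<exists>s G. sub (t m) p = Some s \<and> propagates X (seq_of (t m)) G (addr_ctx (t m) p) (Dia A)"
        using propagates_everywhere[OF node_addr _ _ node_addr X] q by fastforce
    qed
  qed
qed

text \<open>An induction over the initial tree suffices: its formulas belong to the labels and its
  edges to \<open>?E\<close>, whatever later stages add.\<close>

lemma countermodel:
  assumes "closed45 X"
  shows "\<not> X_valid X (seq_of (t 0))"
proof -
  let ?f = "to_nat :: nat list \<Rightarrow> nat" and ?E = "{(p, p @ [i]) | p i. p @ [i] \<in> addrs}"
  have inj: "inj_on ?f addrs" by simp
  obtain R V where R: "X_frame X (?f ` addrs) R" "\<forall>w v. (w, v) \<in> ?E \<longrightarrow> (?f w, ?f v) \<in> R"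
    "\<forall>w\<in>addrs. \<forall>A\<in>label w. \<not> sat R V (?f w) A"
    using hintikka.countermodel[OF hintikka assms inj] by (elim exE conjE)
  have "\<not> holds R V (?f p) (seq_of s)" if "sub (t 0) p = Some s" for p s
    using that
  proof (induction s arbitrary: p)
    case (OT M ts)
    have "\<not> sat R V (?f p) A" if "A \<in># M" for A
    proof -
      have "p \<in> addrs" "A \<in> label p"
        using OT.prems that unfolding addrs_def label_def by force+
      then show ?thesis using R(3) by blast
    qed
    moreover have "\<exists>v. (?f p, v) \<in> R \<and> \<not> holds R V v (seq_of s)" if s: "s \<in> set ts" for s
    proof -
      obtain i where "i < length ts" "s = ts ! i" using s by (auto simp: in_set_conv_nth)
      then have i: "sub (t 0) (p @ [i]) = Some s" using OT.prems by (simp add: sub_snoc)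
      then have "p @ [i] \<in> addrs" unfolding addrs_def by blast
      then show ?thesis using R(2) OT.IH[OF s i] by blast
    qed
    ultimately show ?case by (auto simp: holds_Seq)
  qed
  then have "\<not> holds R V (?f []) (seq_of (t 0))" by simp
  moreover have "[] \<in> addrs" by (simp add: addrs_def)
  ultimately show ?thesis using R(1) unfolding X_valid_def valid_in_def by blast
qed

end

section \<open>Completeness from an infinite unprovable run\<close>

lemma completeness:
  assumes "closed45 X" "X_valid X \<Gamma>"
  shows "provable (KX X) \<Gamma>"
proof (rule ccontr)
  assume np: "\<not> provable (KX X) \<Gamma>"
  obtain t0 where t0: "seq_of t0 = \<Gamma>" using ex_otree by blast
  \<comment> \<open>The clause for \<open>n = 0\<close> fixes the first tree, which dependent choice
    would otherwise leave arbitrary.\<close>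
  have "\<exists>t. \<forall>n. (\<not> provable (KX X) (seq_of (t n)) \<and> (n = 0 \<longrightarrow> t n = t0)) \<and> stage X (task n) (t n) (t (Suc n))"
  proof (rule dependent_nat_choice)
    show "\<exists>t. \<not> provable (KX X) (seq_of t) \<and> (0 = 0 \<longrightarrow> t = t0)" using np t0 by blast
    show "\<exists>t'. (\<not> provable (KX X) (seq_of t') \<and> (Suc n = 0 \<longrightarrow> t' = t0)) \<and> stage X (task n) t t'"
      if "\<not> provable (KX X) (seq_of t) \<and> (n = 0 \<longrightarrow> t = t0)" for t n
      using stage_exists[of X t "fst (task n)" "fst (snd (task n))" "snd (snd (task n))"] that by simp
  qed
  then obtain t where "run X t" "t 0 = t0" by (metis run.intro)
  then show False using run.countermodel assms t0 by blast
qed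

theorem theorem2p23:
  fixes X :: "axm set" and \<Gamma> :: seq
  assumes "closed45 X"
  shows "(X_valid X \<Gamma> \<longrightarrow> provable (KX X) \<Gamma>) \<and>
    (prove_fails \<Gamma> X \<longrightarrow> (\<exists>(W::nat set) R. finite W \<and> X_frame X W R \<and> \<not> valid_in W R \<Gamma>))"
  using completeness[OF assms] prove_fails_countermodel[OF _ assms] by blast

end
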